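(* Let $b\ge 3$ be an odd integer and put $N_b=(b+1)\max\{2b+3,14\}+2$. For even $n\ge N_b$ set $k=\left\lfloor\frac{n-2}{b+1}\right\rfloor$, and for $1\le s\le k$ let $G_s=K_s\nabla\left(K_{n-(b+1)s-1}\cup(bs+1)K_1\right)$. Then for every even $n\ge N_b$ there exists a unique $\alpha_\ast(n,b)\in(\frac12,1)$ such that $\rho_\alpha(G_1)=\rho_\alpha(G_k)$ holds at $\alpha=\alpha_\ast(n,b)$. More precisely, with $\ell=n-(b+1)k-1$, for fixed $b$ and $n\to\infty$ through even integers, $$\alpha_\ast(n,b)=1-\frac{(b+1)^2}{bn}+\frac{(b+1)^2\left(b^3+b\ell-b-1\right)}{b^3n^2}+O(n^{-3}).$$ Consequently, for every even $n\ge N_b$: - for $\frac12<\alpha<\alpha_\ast(n,b)$, $G_1$ is the unique extremal graph in $\{G_s\}_{s=1}^k$; - for $\alpha=\alpha_\ast(n,b)$, both $G_1$ and $G_k$ are the extremal graphs in $\{G_s\}_{s=1}^k$ (and no other $G_s$ is); - for $\alpha_\ast(n,b)<\alpha<1$, $G_k$ is the unique extremal graph in $\{G_s\}_{s=1}^k$.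
   Context: All graphs are simple, finite and undirected. $K_m$ is the complete graph on $m$ vertices, $mK_1$ is the graph with $m$ isolated vertices, $\cup$ is the disjoint union of graphs, and $\nabla$ is the join of two graphs (disjoint union plus all edges between the two). For a graph $G$ with adjacency matrix $A(G)$ and diagonal degree matrix $D(G)$, and $\alpha\in[0,1]$, set $A_\alpha(G)=\alpha D(G)+(1-\alpha)A(G)$, and let $\rho_\alpha(G)$ be the spectral radius of $A_\alpha(G)$. For given $\alpha$, a graph $G_j$ is extremal in $\{G_s\}_{s=1}^k$ if $\rho_\alpha(G_j)=\max_{1\le s\le k}\rho_\alpha(G_s)$. The integer $\ell$ depends on $n$ and satisfies $1\le\ell\le b$; the implied constant in $O(n^{-3})$ may depend on $b$ but not on $n$. *)

theory Defs
  imports "Jordan_Normal_Form.Spectral_Radius" "HOL-Library.Landau_Symbols"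
begin

text \<open>A graph with \<open>m\<close> vertices has vertex set \<open>{0..<m}\<close>; this loses no generality, since
  the spectral radius of \<open>A\<^sub>\<alpha>\<close> does not depend on how the vertices are labelled.\<close>

record sgraph =
  nverts :: nat
  edge :: "nat \<Rightarrow> nat \<Rightarrow> bool"

definition simple_graph :: "sgraph \<Rightarrow> bool" where
  "simple_graph G \<longleftrightarrow>
     (\<forall>i j. edge G i j \<longrightarrow> i < nverts G \<and> j < nverts G \<and> i \<noteq> j \<and> edge G j i)"

definition complete_graph :: "nat \<Rightarrow> sgraph" where
  "complete_graph m = \<lparr>nverts = m, edge = (\<lambda>i j. i < m \<and> j < m \<and> i \<noteq> j)\<rparr>"

definition isolated_vertices :: "nat \<Rightarrow> sgraph" where
  "isolated_vertices m = \<lparr>nverts = m, edge = (\<lambda>i j. False)\<rparr>"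

text \<open>In unions and joins the vertices of the second graph are shifted up by the number of
  vertices of the first.\<close>

definition disjoint_union :: "sgraph \<Rightarrow> sgraph \<Rightarrow> sgraph" where
  "disjoint_union G H =
     \<lparr>nverts = nverts G + nverts H,
      edge = (\<lambda>i j. i < nverts G \<and> j < nverts G \<and> edge G i j \<or>
                    nverts G \<le> i \<and> nverts G \<le> j \<and> edge H (i - nverts G) (j - nverts G))\<rparr>"

definition graph_join :: "sgraph \<Rightarrow> sgraph \<Rightarrow> sgraph" where
  "graph_join G H =
     \<lparr>nverts = nverts G + nverts H,
      edge = (\<lambda>i j. edge (disjoint_union G H) i j \<or>
                    i < nverts G \<and> nverts G \<le> j \<and> j < nverts G + nverts H \<or>
                    j < nverts G \<and> nverts G \<le> i \<and> i < nverts G + nverts H)\<rparr>"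

lemma simple_graph_complete_graph: "simple_graph (complete_graph m)"
  by (auto simp: simple_graph_def complete_graph_def)

lemma simple_graph_isolated_vertices: "simple_graph (isolated_vertices m)"
  by (auto simp: simple_graph_def isolated_vertices_def)

lemma simple_graph_disjoint_union:
  assumes "simple_graph G" "simple_graph H"
  shows "simple_graph (disjoint_union G H)"
  using assms by (fastforce simp: simple_graph_def disjoint_union_def)

lemma simple_graph_graph_join:
  assumes "simple_graph G" "simple_graph H"
  shows "simple_graph (graph_join G H)"
  using simple_graph_disjoint_union[OF assms]
  by (auto simp: simple_graph_def graph_join_def disjoint_union_def)

definition degree_of :: "sgraph \<Rightarrow> nat \<Rightarrow> nat" where
  "degree_of G i = card {j. j < nverts G \<and> edge G i j}"

definition adjacency_matrix :: "sgraph \<Rightarrow> real mat" where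
  "adjacency_matrix G =
     mat (nverts G) (nverts G) (\<lambda>(i, j). if edge G i j then 1 else 0)"

definition degree_matrix :: "sgraph \<Rightarrow> real mat" where
  "degree_matrix G =
     mat (nverts G) (nverts G) (\<lambda>(i, j). if i = j then real (degree_of G i) else 0)"

definition A_alpha :: "real \<Rightarrow> sgraph \<Rightarrow> real mat" where
  "A_alpha \<alpha> G = \<alpha> \<cdot>\<^sub>m degree_matrix G + (1 - \<alpha>) \<cdot>\<^sub>m adjacency_matrix G"

text \<open>The library's \<^const>\<open>spectral_radius\<close> is defined on complex matrices.\<close>

definition rho :: "real \<Rightarrow> sgraph \<Rightarrow> real" where
  "rho \<alpha> G = spectral_radius (map_mat complex_of_real (A_alpha \<alpha> G))"

definition extremal :: "real \<Rightarrow> (nat \<Rightarrow> sgraph) \<Rightarrow> nat \<Rightarrow> nat \<Rightarrow> bool" where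
  "extremal \<alpha> G k j \<longleftrightarrow> j \<in> {1..k} \<and> rho \<alpha> (G j) = (MAX s\<in>{1..k}. rho \<alpha> (G s))"

definition N_min :: "nat \<Rightarrow> nat" where
  "N_min b = (b + 1) * max (2 * b + 3) 14 + 2"

definition k_max :: "nat \<Rightarrow> nat \<Rightarrow> nat" where
  "k_max b n = (n - 2) div (b + 1)"

text \<open>The natural-number subtractions here and in \<open>ell\<close> do not truncate for
  \<open>n \<ge> 2\<close> and \<open>s \<le> k_max b n\<close>, because then \<open>(b + 1) * s \<le> n - 2\<close>.\<close>

definition G_fam :: "nat \<Rightarrow> nat \<Rightarrow> nat \<Rightarrow> sgraph" where
  "G_fam b n s =
     graph_join (complete_graph s)
       (disjoint_union (complete_graph (n - (b + 1) * s - 1)) (isolated_vertices (b * s + 1)))"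

definition ell :: "nat \<Rightarrow> nat \<Rightarrow> nat" where
  "ell b n = n - (b + 1) * k_max b n - 1"

definition crossing :: "nat \<Rightarrow> nat \<Rightarrow> real \<Rightarrow> bool" where
  "crossing b n \<alpha> \<longleftrightarrow>
     1/2 < \<alpha> \<and> \<alpha> < 1 \<and> rho \<alpha> (G_fam b n 1) = rho \<alpha> (G_fam b n (k_max b n))"

definition alpha_star :: "nat \<Rightarrow> nat \<Rightarrow> real" where
  "alpha_star b n = (THE \<alpha>. crossing b n \<alpha>)"

lemma simple_graph_G_fam: "simple_graph (G_fam b n s)"
  unfolding G_fam_def
  by (intro simple_graph_graph_join simple_graph_disjoint_union
        simple_graph_complete_graph simple_graph_isolated_vertices)

lemma nverts_G_fam:
  assumes "2 \<le> n" "s \<le> k_max b n"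
  shows "nverts (G_fam b n s) = n"
proof -
  have "(b + 1) * s \<le> (b + 1) * k_max b n"
    using assms(2) by (rule mult_le_mono2)
  also have "\<dots> \<le> n - 2"
    by (simp only: k_max_def times_div_less_eq_dividend)
  finally have "(b + 1) * s + 2 \<le> n"
    using assms(1) by linarith
  then show ?thesis
    by (simp add: G_fam_def graph_join_def disjoint_union_def complete_graph_def
          isolated_vertices_def algebra_simps)
qed

end

theory Submission
  imports Defs
begin

text \<open>The partition of \<open>G\<^sub>s\<close> into its three parts is equitable, so \<open>A\<^sub>\<alpha>\<close> has a positive eigenvector
  constant on the parts, and \<open>\<rho>\<^sub>\<alpha>(G\<^sub>s)\<close> is the only zero beyond the poles of a function \<open>F\<^sub>s\<close> that
  increases there. For fixed \<open>x\<close>, clearing denominators turns \<open>F\<^sub>s(x)\<close> into a cubic polynomial in \<open>s\<close>.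
  If \<open>x\<close> were the maximum of the spectral radii and attained at some \<open>1 < j < k\<close>, the second divided
  difference of this cubic at \<open>1, j, k\<close> would be nonnegative, but its coefficients make it negative.
  So only \<open>G\<^sub>1\<close> and \<open>G\<^sub>k\<close> compete.

  Put \<open>\<beta> = 1 - \<alpha>\<close> and \<open>\<rho>\<^sub>\<alpha>(G\<^sub>1) = m + u \<beta>\<close>, where \<open>m = n - b - 2\<close> is the spectral radius of the largest
  clique of \<open>G\<^sub>1\<close>. On the curve \<open>F\<^sub>1 = 0\<close> the number \<open>u\<close> decreases in \<open>\<beta>\<close>, and the sign of
  \<open>\<rho>\<^sub>\<alpha>(G\<^sub>k) - \<rho>\<^sub>\<alpha>(G\<^sub>1)\<close> is that of \<open>T = k - 1 + \<theta> - m / (1 + u)\<close> with a bounded correction \<open>\<theta>\<close>. The term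
  \<open>m / (1 + u)\<close> dominates every change of \<open>T\<close>, so \<open>T\<close> changes sign exactly once. At the crossing
  \<open>m / (1 + u) = k - 1 + \<theta>\<close> with \<open>\<theta> = (b + 1) / b + O(1 / n)\<close>; inserting this into \<open>F\<^sub>1 = 0\<close> gives the
  expansion.\<close>

section \<open>Spectral radii from positive eigenvectors\<close>

text \<open>Any complex eigenvector \<open>z\<close> is compared with the weights \<open>v\<close>:
  in the row where \<open>norm (z $ i) / v i\<close> is largest, the triangle inequality gives
  \<open>norm \<mu> \<le> x\<close>. The eigenvalue \<open>x\<close> itself attains the
  bound.\<close>

lemma spectral_radius_eq_positive_eigenvector:
  fixes A :: "real mat" and v :: "nat \<Rightarrow> real"
  assumes A: "A \<in> carrier_mat n n" and n: "n > 0"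
    and nonneg: "\<And>i j. i < n \<Longrightarrow> j < n \<Longrightarrow> 0 \<le> A $$ (i, j)"
    and pos: "\<And>i. i < n \<Longrightarrow> 0 < v i"
    and eig: "\<And>i. i < n \<Longrightarrow> (\<Sum>j<n. A $$ (i, j) * v j) = x * v i"
  shows "spectral_radius (map_mat complex_of_real A) = x"
proof -
  define C where "C = map_mat complex_of_real A"
  have C: "C \<in> carrier_mat n n"
    using A by (simp add: C_def)
  have mult_index: "(C *\<^sub>v z) $ i = (\<Sum>j<n. complex_of_real (A $$ (i, j)) * z $ j)"
    if "i < n" "z \<in> carrier_vec n" for z i
    using that A C by (auto simp: C_def scalar_prod_def lessThan_atLeast0 intro!: sum.cong)
  have "0 \<le> (\<Sum>j<n. A $$ (0, j) * v j)"
    using nonneg pos n by (intro sum_nonneg mult_nonneg_nonneg) (auto intro: less_imp_le)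
  then have x0: "x \<ge> 0"
    using eig[OF n] pos[OF n] by (simp add: zero_le_mult_iff)
  have bound: "norm \<mu> \<le> x" if ev: "eigenvalue C \<mu>" for \<mu>
  proof -
    obtain z where z: "z \<in> carrier_vec n" "z \<noteq> 0\<^sub>v n" "C *\<^sub>v z = \<mu> \<cdot>\<^sub>v z"
      using ev C unfolding eigenvalue_def eigenvector_def by auto
    define q where "q i = norm (z $ i) / v i" for i
    obtain i where i: "i < n" "\<And>j. j < n \<Longrightarrow> q j \<le> q i"
    proof -
      have "Max (q ` {..<n}) \<in> q ` {..<n}"
        using n by (intro Max_in) auto
      then obtain i where "i < n" "q i = Max (q ` {..<n})" by auto
      then show thesis
        using that[of i] by (metis Max_ge finite_imageI finite_lessThan imageI lessThan_iff)
    qed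
    have le: "norm (z $ j) \<le> q i * v j" if "j < n" for j
      using i(2)[OF that] pos[OF that] by (simp add: q_def[of j] divide_le_eq)
    \<comment> \<open>Since \<open>z\<close> is nonzero, the largest quotient is positive, so
      \<open>norm (z $ i)\<close> can be cancelled at the end.\<close>
    have qi: "q i > 0"
    proof -
      obtain j where "j < n" "z $ j \<noteq> 0"
        using z(1,2) by (metis carrier_vecD eq_vecI index_zero_vec(1,2))
      then show ?thesis
        using le[of j] pos[of j] by (smt (verit) mult_nonpos_nonneg zero_less_norm_iff)
    qed
    have "norm \<mu> * norm (z $ i) = norm ((C *\<^sub>v z) $ i)"
      using z i(1) by (simp add: norm_mult)
    also have "\<dots> \<le> (\<Sum>j<n. norm (complex_of_real (A $$ (i, j)) * z $ j))"
      unfolding mult_index[OF i(1) z(1)] by (rule norm_sum)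
    also have "\<dots> \<le> (\<Sum>j<n. A $$ (i, j) * (q i * v j))"
      using nonneg[OF i(1)] le by (intro sum_mono) (auto simp: norm_mult intro!: mult_left_mono)
    also have "\<dots> = q i * (\<Sum>j<n. A $$ (i, j) * v j)"
      by (simp add: sum_distrib_left mult_ac)
    also have "\<dots> = x * norm (z $ i)"
      using eig[OF i(1)] pos[OF i(1)] by (simp add: q_def)
    finally have "norm \<mu> * norm (z $ i) \<le> x * norm (z $ i)" .
    moreover have "norm (z $ i) > 0"
      using qi pos[OF i(1)] by (simp add: q_def zero_less_divide_iff)
    ultimately show ?thesis by simp
  qed
  define w where "w = vec n (\<lambda>i. complex_of_real (v i))"
  have "C *\<^sub>v w = complex_of_real x \<cdot>\<^sub>v w"
  proof (rule eq_vecI)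
    fix i assume "i < dim_vec (complex_of_real x \<cdot>\<^sub>v w)"
    then have i: "i < n" by (simp add: w_def)
    have "(C *\<^sub>v w) $ i = complex_of_real (\<Sum>j<n. A $$ (i, j) * v j)"
      using mult_index[OF i, of w] by (simp add: w_def)
    then show "(C *\<^sub>v w) $ i = (complex_of_real x \<cdot>\<^sub>v w) $ i"
      using eig[OF i] i by (simp add: w_def)
  qed (use C in \<open>simp add: w_def\<close>)
  moreover have "w \<noteq> 0\<^sub>v n"
    using pos[OF n] n by (auto simp: w_def vec_eq_iff)
  ultimately have "eigenvalue C (complex_of_real x)"
    using C unfolding eigenvalue_def eigenvector_def by (intro exI[of _ w]) (auto simp: w_def)
  then have "x \<in> norm ` spectrum C"
    using x0 by (force simp: spectrum_def image_iff)
  then have "x \<le> spectral_radius C"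
    by (rule spectral_radius_mem_max(2)[OF C n])
  moreover have "spectral_radius C \<le> x"
    using spectral_radius_mem_max(1)[OF C n] bound by (auto simp: spectrum_def)
  ultimately show ?thesis by (simp add: C_def)
qed

lemma rho_eq_positive_eigenvector:
  fixes v :: "nat \<Rightarrow> real"
  assumes "0 \<le> \<alpha>" "\<alpha> \<le> 1" and n: "0 < nverts G"
    and irrefl: "\<And>i. i < nverts G \<Longrightarrow> \<not> edge G i i"
    and pos: "\<And>i. i < nverts G \<Longrightarrow> 0 < v i"
    and eig: "\<And>i. i < nverts G \<Longrightarrow>
      \<alpha> * real (card {j. j < nverts G \<and> edge G i j}) * v i
        + (1 - \<alpha>) * sum v {j. j < nverts G \<and> edge G i j} = x * v i"
  shows "rho \<alpha> G = x"
  unfolding rho_def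
proof (rule spectral_radius_eq_positive_eigenvector[OF _ n])
  show "A_alpha \<alpha> G \<in> carrier_mat (nverts G) (nverts G)"
    by (simp add: A_alpha_def degree_matrix_def adjacency_matrix_def)
  have entry: "A_alpha \<alpha> G $$ (i, j) =
      (if j = i then \<alpha> * real (degree_of G i) else 0) + (if edge G i j then 1 - \<alpha> else 0)"
    if "i < nverts G" "j < nverts G" for i j
    using that by (auto simp: A_alpha_def degree_matrix_def adjacency_matrix_def)
  show "0 \<le> A_alpha \<alpha> G $$ (i, j)" if "i < nverts G" "j < nverts G" for i j
    using entry[OF that] assms(1,2) by auto
  show "(\<Sum>j<nverts G. A_alpha \<alpha> G $$ (i, j) * v j) = x * v i" if i: "i < nverts G" for i
  proof -
    have "(\<Sum>j<nverts G. A_alpha \<alpha> G $$ (i, j) * v j) =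
        (\<Sum>j<nverts G. if j = i then \<alpha> * real (degree_of G i) * v j else 0)
        + (\<Sum>j<nverts G. if edge G i j then (1 - \<alpha>) * v j else 0)"
      unfolding sum.distrib[symmetric] using i
      by (intro sum.cong refl) (auto simp: entry algebra_simps)
    also have "(\<Sum>j<nverts G. if edge G i j then (1 - \<alpha>) * v j else 0)
        = (\<Sum>j\<in>{j \<in> {..<nverts G}. edge G i j}. (1 - \<alpha>) * v j)"
      by (simp only: sum.inter_filter[OF finite_lessThan])
    also have "\<dots> = (1 - \<alpha>) * sum v {j. j < nverts G \<and> edge G i j}"
      by (simp only: sum_distrib_left lessThan_iff)
    also have "(\<Sum>j<nverts G. if j = i then \<alpha> * real (degree_of G i) * v j else 0)
        = \<alpha> * real (degree_of G i) * v i"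
      using i by simp
    finally show ?thesis
      using eig[OF i] by (simp add: degree_of_def)
  qed
qed (use pos in auto)

text \<open>Solving the eigenvalue equations on the clique of size \<open>m\<close> and on the \<open>t\<close> isolated vertices
  and inserting the result into the equation on the dominating clique of size \<open>s\<close> leaves
  \<open>quot_fun s m t \<beta> x = 0\<close>, with \<open>\<alpha> = 1 - \<beta>\<close>.\<close>

definition quot_fun :: "real \<Rightarrow> real \<Rightarrow> real \<Rightarrow> real \<Rightarrow> real \<Rightarrow> real" where
  "quot_fun s m t \<beta> x = x - (1 - \<beta>) * (s + m + t - 1) - \<beta> * (s - 1)
     - \<beta>\<^sup>2 * s * (m / (x - (m - 1) - (1 - \<beta>) * s) + t / (x - (1 - \<beta>) * s))"

definition split_graph :: "nat \<Rightarrow> nat \<Rightarrow> nat \<Rightarrow> sgraph" where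
  "split_graph s m t =
     graph_join (complete_graph s) (disjoint_union (complete_graph m) (isolated_vertices t))"

lemma nverts_split_graph: "nverts (split_graph s m t) = s + m + t"
  by (simp add: split_graph_def graph_join_def disjoint_union_def complete_graph_def
      isolated_vertices_def)

lemma edge_split_graph:
  "edge (split_graph s m t) i j \<longleftrightarrow>
     i < s + m + t \<and> j < s + m + t \<and> i \<noteq> j \<and> (i < s \<or> j < s \<or> i < s + m \<and> j < s + m)"
  by (auto simp: split_graph_def graph_join_def disjoint_union_def complete_graph_def
      isolated_vertices_def)

text \<open>Lying beyond the larger pole makes the eigenvector positive on all three parts, which
  singles out the spectral radius among the zeros of \<open>quot_fun\<close>.\<close>

lemma rho_split_graph_root:
  fixes s m t :: nat
  assumes s: "1 \<le> s" and m: "1 \<le> m" and \<beta>: "0 < \<beta>" "\<beta> < 1"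
    and root: "quot_fun s m t \<beta> x = 0"
    and x: "x > real m - 1 + (1 - \<beta>) * real s"
  shows "rho (1 - \<beta>) (split_graph s m t) = x"
proof -
  define p where "p = x - (real m - 1) - (1 - \<beta>) * real s"
  define q where "q = x - (1 - \<beta>) * real s"
  have p: "p > 0" and q: "q > 0" using x m by (auto simp: p_def q_def)
  \<comment> \<open>With entry 1 on the dominating clique, the eigenvalue equations on the other two
    parts read \<open>p * e = \<beta> * s\<close> and \<open>q * f = \<beta> * s\<close>; the
    remaining one is \<open>root\<close>.\<close>
  define e where "e = \<beta> * real s / p"
  define f where "f = \<beta> * real s / q"
  have e: "e > 0" "\<beta> * real s = p * e" and f: "f > 0" "\<beta> * real s = q * f"
    using s \<beta> p q by (simp_all add: e_def f_def)
  define v where "v i = (if i < s then 1 else if i < s + m then e else f)" for i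
  let ?G = "split_graph s m t" and ?n = "s + m + t"
  have vS: "sum v {0..<s} = real s" and vM: "sum v {s..<s + m} = real m * e"
    and vT: "sum v {s + m..<?n} = real t * f"
    by (simp_all add: v_def)
  have vSM: "sum v {0..<s + m} = real s + real m * e"
    using sum.atLeastLessThan_concat[of 0 s "s + m" v] vS vM by simp
  have vall: "sum v {0..<?n} = real s + real m * e + real t * f"
    using sum.atLeastLessThan_concat[of 0 "s + m" ?n v] vSM vT by simp
  show ?thesis
  proof (rule rho_eq_positive_eigenvector[where v = v])
    show "0 < v i" if "i < nverts ?G" for i
      using e f by (simp add: v_def)
    fix i assume i: "i < nverts ?G"
    let ?N = "{j. j < nverts ?G \<and> edge ?G i j}"
    consider "i < s" | "s \<le> i" "i < s + m" | "s + m \<le> i" by linarith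
    then show "(1 - \<beta>) * real (card ?N) * v i + (1 - (1 - \<beta>)) * sum v ?N = x * v i"
    proof cases
      case 1
      then have N: "?N = {0..<?n} - {i}"
        by (auto simp: nverts_split_graph edge_split_graph)
      have c: "real (card ?N) = real s + real m + real t - 1"
        using 1 by (simp add: N of_nat_diff)
      have v1: "v i = 1" using 1 by (simp add: v_def)
      have d: "sum v ?N = real s + real m * e + real t * f - 1"
        using 1 v1 unfolding N by (subst sum_diff1) (simp_all add: vall)
      have "\<beta>\<^sup>2 * real s * (real m / p + real t / q) = \<beta> * (real m * e + real t * f)"
        unfolding e_def f_def
        by (simp only: divide_inverse power2_eq_square ring_distribs mult_ac add_ac)
      then have x_eq: "x = (1 - \<beta>) * (real s + real m + real t - 1) + \<beta> * (real s - 1)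
          + \<beta> * (real m * e + real t * f)"
        using root unfolding quot_fun_def p_def[symmetric] q_def[symmetric] by linarith
      show ?thesis
        unfolding c d v1 using x_eq by Groebner_Basis.algebra
    next
      case 2
      then have N: "?N = {0..<s + m} - {i}"
        by (auto simp: nverts_split_graph edge_split_graph)
      have v: "v i = e" using 2 by (simp add: v_def)
      have c: "real (card ?N) = real s + real m - 1"
        using 2 by (simp add: N of_nat_diff)
      have d: "sum v ?N = real s + real m * e - e"
        using 2 v unfolding N by (subst sum_diff1) (simp_all add: vSM)
      show ?thesis
        unfolding c d v using e(2) unfolding p_def by Groebner_Basis.algebra
    next
      case 3
      then have N: "?N = {0..<s}"
        using i by (auto simp: nverts_split_graph edge_split_graph)
      have v: "v i = f" using 3 by (simp add: v_def)
      have c: "real (card ?N) = real s" by (simp add: N)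
      have d: "sum v ?N = real s" by (simp add: N vS)
      show ?thesis
        unfolding c d v using f(2) unfolding q_def by Groebner_Basis.algebra
    qed
  qed (use \<beta> s m in \<open>auto simp: nverts_split_graph edge_split_graph\<close>)
qed

section \<open>The unique zero of \<open>quot_fun\<close> beyond its poles\<close>

lemma quot_fun_strict_mono:
  assumes "0 \<le> s" "1 \<le> m" "0 \<le> t" "m - 1 + (1 - \<beta>) * s < x" "x < y"
  shows "quot_fun s m t \<beta> x < quot_fun s m t \<beta> y"
proof -
  have "m / (y - (m - 1) - (1 - \<beta>) * s) \<le> m / (x - (m - 1) - (1 - \<beta>) * s)"
    using assms by (intro divide_left_mono mult_pos_pos) auto
  moreover have "t / (y - (1 - \<beta>) * s) \<le> t / (x - (1 - \<beta>) * s)"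
    using assms by (intro divide_left_mono mult_pos_pos) auto
  ultimately have "\<beta>\<^sup>2 * s * (m / (y - (m - 1) - (1 - \<beta>) * s) + t / (y - (1 - \<beta>) * s))
      \<le> \<beta>\<^sup>2 * s * (m / (x - (m - 1) - (1 - \<beta>) * s) + t / (x - (1 - \<beta>) * s))"
    using assms(1) by (intro mult_left_mono add_mono) auto
  then show ?thesis
    using assms(5) unfolding quot_fun_def by linarith
qed

text \<open>Intermediate value theorem between a point just beyond the larger pole, where the term
  with \<open>m\<close> dominates, and \<open>3 * N\<close>, where both denominators are at least
  \<open>N\<close>.\<close>

lemma quot_fun_has_root:
  assumes s: "1 \<le> s" and m: "1 \<le> m" and t: "s \<le> t" and \<beta>: "0 < \<beta>" "\<beta> < 1"
  shows "\<exists>x > m - 1 + (1 - \<beta>) * s. quot_fun s m t \<beta> x = 0"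
proof -
  define p where "p = m - 1 + (1 - \<beta>) * s"
  define N where "N = s + m + t"
  \<comment> \<open>Chosen so that \<open>\<beta>\<^sup>2 * s * (m / h) = N\<close>, which outweighs
    \<open>p + h\<close>: the bound \<open>p + h \<le> N\<close> follows from
    \<open>h \<le> s \<le> t\<close>.\<close>
  define h where "h = \<beta>\<^sup>2 * s * m / N"
  have N: "N > 0" and p0: "p \<ge> 0" "(1 - \<beta>) * s \<le> p" and ps: "p \<le> m - 1 + s"
    using s m t \<beta> by (auto simp: N_def p_def mult_left_le_one_le)
  have \<beta>2: "\<beta>\<^sup>2 \<le> 1"
    using \<beta> by (simp add: power_le_one)
  have h0: "h > 0"
    using s m N \<beta> by (simp add: h_def)
  have "\<beta>\<^sup>2 * (s * m) \<le> 1 * (s * N)"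
    using s m t \<beta>2 by (intro mult_mono) (auto simp: N_def)
  then have hs: "h \<le> s"
    using N by (simp add: h_def divide_le_eq mult.assoc)
  have low: "quot_fun s m t \<beta> (p + h) \<le> 0"
  proof -
    have "\<beta>\<^sup>2 * s * (m / h) = N"
      using h0 N s m \<beta> by (simp add: h_def)
    moreover have "\<beta>\<^sup>2 * s * (m / h + t / (p + h - (1 - \<beta>) * s)) \<ge> \<beta>\<^sup>2 * s * (m / h)"
      using s t p0 h0 by (intro mult_left_mono) auto
    moreover have "(1 - \<beta>) * (N - 1) \<ge> 0" "\<beta> * (s - 1) \<ge> 0"
      using \<beta> s m t by (auto simp: N_def)
    moreover have pole: "p + h - (m - 1) - (1 - \<beta>) * s = h"
      by (simp add: p_def)
    moreover have "p + h \<le> N" using ps hs s t by (simp add: N_def)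
    ultimately show ?thesis
      unfolding quot_fun_def N_def[symmetric] pole by linarith
  qed
  have "p + h \<le> 3 * N"
    using ps hs s m t by (simp add: N_def)
  have "0 \<le> quot_fun s m t \<beta> (3 * N)"
  proof -
    define z where "z = (1 - \<beta>) * s"
    have z: "z \<le> s" using ps by (simp add: p_def z_def)
    have d: "N \<le> 3 * N - (m - 1) - (1 - \<beta>) * s" "N \<le> 3 * N - (1 - \<beta>) * s"
      using z s m t unfolding N_def z_def[symmetric] by auto
    have "m / (3 * N - (m - 1) - (1 - \<beta>) * s) \<le> m / N" "t / (3 * N - (1 - \<beta>) * s) \<le> t / N"
      using d N s m t by (intro divide_left_mono mult_pos_pos; simp)+
    then have "m / (3 * N - (m - 1) - (1 - \<beta>) * s) + t / (3 * N - (1 - \<beta>) * s) \<le> m / N + t / N"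
      by (rule add_mono)
    also have "\<dots> \<le> 1"
      using N s by (simp add: N_def flip: add_divide_distrib)
    finally have "\<beta>\<^sup>2 * s * (m / (3 * N - (m - 1) - (1 - \<beta>) * s) + t / (3 * N - (1 - \<beta>) * s))
        \<le> 1 * s * 1"
      using d N s m t \<beta>2 by (intro mult_mono) auto
    then have le_s: "\<beta>\<^sup>2 * s * (m / (3 * N - (m - 1) - (1 - \<beta>) * s) + t / (3 * N - (1 - \<beta>) * s))
        \<le> s" by simp
    have "(1 - \<beta>) * (N - 1) \<le> N - 1" "\<beta> * (s - 1) \<le> s - 1"
      using \<beta> s m t by (auto simp: N_def intro!: mult_left_le_one_le)
    moreover have "3 * N - (N - 1) - (s - 1) - s \<ge> 0"
      using s m t by (simp add: N_def)
    ultimately show ?thesis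
      using le_s unfolding quot_fun_def N_def[symmetric] by linarith
  qed
  moreover have "continuous_on {p + h..3 * N} (quot_fun s m t \<beta>)"
    unfolding quot_fun_def using h0 p0 by (intro continuous_intros) (auto simp: p_def)
  ultimately obtain x where "p + h \<le> x" "quot_fun s m t \<beta> x = 0"
    using IVT'[of "quot_fun s m t \<beta>" "p + h" 0 "3 * N"] low \<open>p + h \<le> 3 * N\<close> by auto
  then show ?thesis
    using h0 by (intro exI[of _ x]) (auto simp: p_def)
qed

text \<open>Up to the factor \<open>(k - 1) * (k - j) * (j - 1)\<close>, both sides are the second
  divided difference at \<open>1, j, k\<close>. It vanishes on polynomials of degree at most 1, is 1
  on the square and \<open>1 + j + k\<close> on the cube.\<close>

lemma cubic_divided_difference:
  fixes p :: "real \<Rightarrow> real"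
  assumes "\<And>s. p s = c\<^sub>0 + c\<^sub>1 * s + c\<^sub>2 * s ^ 2 + c\<^sub>3 * s ^ 3"
  shows "p 1 * (k - j) + p k * (j - 1) - p j * (k - 1)
    = (k - 1) * (k - j) * (j - 1) * (c\<^sub>2 + c\<^sub>3 * (1 + j + k))"
  unfolding assms by (simp add: algebra_simps power2_eq_square power3_eq_cube)

section \<open>The family at fixed order\<close>

text \<open>Real parameters let \<open>s\<close> act as a polynomial variable and avoid casts.
  \<open>l\<close> stands for \<open>ell\<close>, and the two lower bounds on \<open>k\<close> are
  what \<open>N_min\<close> guarantees.\<close>

locale extremal_family =
  fixes b k l :: real
  assumes b: "3 \<le> b" and k: "14 \<le> k" "2 * b + 3 \<le> k" and l: "1 \<le> l" "l \<le> b"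
begin

definition n where "n = (b + 1) * k + l + 1"

text \<open>The size \<open>n - (b + 1) * s - 1\<close> of the clique outside the dominating
  one.\<close>

definition M where "M s = (b + 1) * (k - s) + l"

definition F where "F s \<beta> x = quot_fun s (M s) (b * s + 1) \<beta> x"

definition r where "r s \<beta> = (THE x. M s - 1 + (1 - \<beta>) * s < x \<and> F s \<beta> x = 0)"

lemma M_ge: "s \<le> k \<Longrightarrow> 1 \<le> M s"
  unfolding M_def using b l by (smt (verit) mult_nonneg_nonneg)

lemma F_strict_mono:
  "1 \<le> s \<Longrightarrow> s \<le> k \<Longrightarrow> M s - 1 + (1 - \<beta>) * s < x \<Longrightarrow> x < y \<Longrightarrow> F s \<beta> x < F s \<beta> y"
  unfolding F_def using M_ge b by (intro quot_fun_strict_mono) auto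

lemma r_root:
  assumes "1 \<le> s" "s \<le> k" "0 < \<beta>" "\<beta> < 1"
  shows "M s - 1 + (1 - \<beta>) * s < r s \<beta>" "F s \<beta> (r s \<beta>) = 0"
proof -
  have "s * 1 \<le> s * b" using b assms by (intro mult_left_mono) auto
  then have "s \<le> b * s + 1" by (simp add: mult.commute)
  then obtain x where x: "M s - 1 + (1 - \<beta>) * s < x \<and> F s \<beta> x = 0"
    using quot_fun_has_root[of s "M s" "b * s + 1" \<beta>] assms M_ge unfolding F_def by blast
  moreover have "y = x" if "M s - 1 + (1 - \<beta>) * s < y \<and> F s \<beta> y = 0" for y
    using that x F_strict_mono[OF assms(1,2)] by (metis linorder_neqE_linordered_idom less_irrefl)
  ultimately have "M s - 1 + (1 - \<beta>) * s < r s \<beta> \<and> F s \<beta> (r s \<beta>) = 0"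
    unfolding r_def by (rule theI)
  then show "M s - 1 + (1 - \<beta>) * s < r s \<beta>" "F s \<beta> (r s \<beta>) = 0" by auto
qed

text \<open>The sign test behind the comparisons of radii: \<open>F s \<beta>\<close> increases
  beyond the pole, so evaluating it at \<open>x\<close> locates \<open>x\<close> relative to a root
  that is never computed.\<close>

lemma less_r_iff:
  assumes "1 \<le> s" "s \<le> k" "0 < \<beta>" "\<beta> < 1" "M s - 1 + (1 - \<beta>) * s < x"
  shows "x < r s \<beta> \<longleftrightarrow> F s \<beta> x < 0" "x = r s \<beta> \<longleftrightarrow> F s \<beta> x = 0"
proof -
  note mono = F_strict_mono[OF assms(1,2), of \<beta>]
  have "F s \<beta> x < 0" if "x < r s \<beta>"
    using mono[OF assms(5) that] r_root(2)[OF assms(1-4)] by simp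
  moreover have "F s \<beta> x > 0" if "r s \<beta> < x"
    using mono[OF r_root(1)[OF assms(1-4)] that] r_root(2)[OF assms(1-4)] by simp
  moreover have "F s \<beta> x = 0" if "x = r s \<beta>"
    using r_root(2)[OF assms(1-4)] that by simp
  ultimately show "x < r s \<beta> \<longleftrightarrow> F s \<beta> x < 0" "x = r s \<beta> \<longleftrightarrow> F s \<beta> x = 0"
    by (cases x "r s \<beta>" rule: linorder_cases; fastforce)+
qed

definition m where "m = (b + 1) * (k - 1) + l"

lemma m_ge: "4 * k - 3 \<le> m" and m_ge': "(b + 1) * (k - 1) < m" and m_le: "m \<le> (b + 2) * (k - 1)"
proof -
  have "4 * (k - 1) \<le> (b + 1) * (k - 1)" using b k by (intro mult_right_mono) auto
  then show "4 * k - 3 \<le> m" "(b + 1) * (k - 1) < m" "m \<le> (b + 2) * (k - 1)"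
    using b k l by (auto simp: m_def algebra_simps)
qed

lemma n_eq: "n = m + b + 2" and M_1: "M 1 = m" and M_k: "M k = l"
  by (auto simp: n_def m_def M_def algebra_simps)

text \<open>At \<open>x = m\<close> the distance to the larger pole is exactly
  \<open>\<beta>\<close>, so the large terms of \<open>F 1 \<beta>\<close> cancel and only negative
  ones remain.\<close>

lemma m_less_r_1:
  assumes "0 < \<beta>" "\<beta> < 1"
  shows "m < r 1 \<beta>"
proof -
  have "F 1 \<beta> m = - (1 - \<beta>) * (b + 1) - \<beta>\<^sup>2 * ((b + 1) / (m - (1 - \<beta>)))"
    unfolding F_def quot_fun_def M_1 using assms by (simp add: field_simps power2_eq_square)
  moreover have "(1 - \<beta>) * (b + 1) > 0" "\<beta>\<^sup>2 * ((b + 1) / (m - (1 - \<beta>))) \<ge> 0"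
    using assms b k m_ge by auto
  ultimately have "F 1 \<beta> m < 0" by linarith
  then show ?thesis
    using less_r_iff(1)[of 1 \<beta> m] assms k by (simp add: M_1)
qed

lemma interior_less:
  assumes \<beta>: "0 < \<beta>" "\<beta> \<le> 1 / 2" and j: "1 < j" "j < k"
  shows "r j \<beta> < max (r 1 \<beta>) (r k \<beta>)"
proof (rule ccontr)
  define x where "x = r j \<beta>"
  assume "\<not> r j \<beta> < max (r 1 \<beta>) (r k \<beta>)"
  then have x: "r 1 \<beta> \<le> x" "r k \<beta> \<le> x" by (auto simp: x_def)
  have xm: "m < x" using m_less_r_1[of \<beta>] x \<beta> by simp
  define p where "p s = x - (M s - 1) - (1 - \<beta>) * s" for s
  define q where "q s = x - (1 - \<beta>) * s" for s
  \<comment> \<open>Beyond the poles \<open>p s\<close> and \<open>q s\<close> are positive, so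
    clearing denominators preserves the sign of \<open>F s \<beta> x\<close>.\<close>
  define P where "P s = F s \<beta> x * p s * q s" for s
  have pole: "p s > 0 \<and> q s > 0" if "1 \<le> s" "s \<le> k" "r s \<beta> \<le> x" for s
    using r_root(1)[of s \<beta>] M_ge[of s] that \<beta> by (simp add: p_def q_def)
  have nonneg: "P s \<ge> 0" if "1 \<le> s" "s \<le> k" "r s \<beta> \<le> x" for s
  proof -
    have "F s \<beta> x \<ge> 0"
      using less_r_iff(1)[of s \<beta> x] r_root(1)[of s \<beta>] that \<beta> by force
    then show ?thesis using pole[OF that] by (simp add: P_def)
  qed
  have Fj: "F j \<beta> x = 0" using r_root(2)[of j \<beta>] j \<beta> by (simp add: x_def)
  \<comment> \<open>As functions of \<open>s\<close>, the three linear factors to be multiplied are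
    \<open>A - \<beta> * s\<close>, \<open>B + \<gamma> * s\<close> (which is \<open>p s\<close>)
    and \<open>x - (1 - \<beta>) * s\<close> (which is \<open>q s\<close>).\<close>
  define \<gamma> where "\<gamma> = b + \<beta>"
  define A where "A = x - (1 - \<beta>) * (n - 1) + \<beta>"
  define B where "B = x - (n - 2)"
  define c\<^sub>2 where "c\<^sub>2 = - \<beta> * \<gamma> * x + (1 - \<beta>) * \<beta> * B - (1 - \<beta>) * \<gamma> * A
      + \<beta>\<^sup>2 * ((1 - \<beta>) * n + x + b * (n - 2) - (b + 1))"
  define c\<^sub>3 where "c\<^sub>3 = \<beta> * b * (1 - \<beta> * (b + 2))"
  define c\<^sub>0 where "c\<^sub>0 = A * B * x"
  define c\<^sub>1 where "c\<^sub>1 = - \<beta> * B * x + A * \<gamma> * x - A * B * (1 - \<beta>) - \<beta>\<^sup>2 * (n * x - (n - 2))"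
  define R where "R s = c\<^sub>0 + c\<^sub>1 * s + c\<^sub>2 * s ^ 2 + c\<^sub>3 * s ^ 3" for s
  have PR: "P s = R s" if "1 \<le> s" "s \<le> k" "r s \<beta> \<le> x" for s
  proof -
    have "P s = (x - (1 - \<beta>) * (n - 1) - \<beta> * (s - 1)) * p s * q s
        - \<beta>\<^sup>2 * s * ((M s / p s + (b * s + 1) / q s) * p s * q s)"
      unfolding P_def F_def quot_fun_def p_def[symmetric] q_def[symmetric]
      by (simp add: M_def n_def algebra_simps)
    also have "(M s / p s + (b * s + 1) / q s) * p s * q s = M s * q s + (b * s + 1) * p s"
      using pole[OF that] by (simp add: field_simps)
    also have "(x - (1 - \<beta>) * (n - 1) - \<beta> * (s - 1)) * p s * q s
        - \<beta>\<^sup>2 * s * (M s * q s + (b * s + 1) * p s) = R s"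
      unfolding p_def q_def M_def R_def c\<^sub>0_def c\<^sub>1_def c\<^sub>2_def c\<^sub>3_def A_def B_def \<gamma>_def n_def
      by (simp add: algebra_simps power2_eq_square power3_eq_cube)
    finally show ?thesis .
  qed
  have "R 1 * (k - j) + R k * (j - 1) - R j * (k - 1)
      = (k - 1) * (k - j) * (j - 1) * (c\<^sub>2 + c\<^sub>3 * (1 + j + k))"
    by (rule cubic_divided_difference) (simp add: R_def)
  moreover have "R 1 \<ge> 0" "R k \<ge> 0" "R j = 0"
    using PR[of 1] PR[of k] PR[of j] nonneg[of 1] nonneg[of k] x k j Fj
    by (auto simp: P_def x_def)
  moreover have "R 1 * (k - j) \<ge> 0" "R k * (j - 1) \<ge> 0"
    using calculation j by (auto intro!: mult_nonneg_nonneg)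
  ultimately have "(k - 1) * (k - j) * (j - 1) * (c\<^sub>2 + c\<^sub>3 * (1 + j + k)) \<ge> 0"
    by simp
  moreover have "(k - 1) * (k - j) * (j - 1) > 0"
    using j by simp
  ultimately have c_nonneg: "c\<^sub>2 + c\<^sub>3 * (1 + j + k) \<ge> 0"
    using mult_pos_neg[of "(k - 1) * (k - j) * (j - 1)" "c\<^sub>2 + c\<^sub>3 * (1 + j + k)"] by linarith
  define J where "J = 1 + j + k"
  have J': "0 \<le> J" "J \<le> 2 * k + 1" using j by (auto simp: J_def)
  \<comment> \<open>At the zero of \<open>F j \<beta>\<close> the linear part equals the nonnegative
    quotient part; this bounds \<open>x\<close> from below.\<close>
  have A: "A > 0"
  proof -
    have "\<beta>\<^sup>2 * j * (M j / p j + (b * j + 1) / q j) \<ge> 0"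
      using pole[of j] j b M_ge[of j] by (simp add: x_def)
    moreover have "j + M j + (b * j + 1) = n"
      by (simp add: M_def n_def algebra_simps)
    ultimately have "x - (1 - \<beta>) * (n - 1) - \<beta> * (j - 1) \<ge> 0"
      using Fj unfolding F_def quot_fun_def p_def[symmetric] q_def[symmetric]
      by (simp add: add.assoc)
    moreover have "\<beta> * (j - 1) \<ge> 0" using j \<beta> by simp
    ultimately show ?thesis using \<beta> by (simp add: A_def)
  qed
  define L where "L = (b - 1 + \<beta>) * x + (1 - \<beta>) * (n - 2) - \<beta> * (1 - \<beta>) * n - \<beta> * b * (n - 2)
      + \<beta> * (b + 1)"
  have neg: "- (c\<^sub>2 + c\<^sub>3 * J) = \<beta> * (L - b * (1 - \<beta> * (b + 2)) * J) + (1 - \<beta>) * \<gamma> * A"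
    unfolding c\<^sub>2_def c\<^sub>3_def L_def B_def \<gamma>_def by (simp add: algebra_simps power2_eq_square power3_eq_cube)
  \<comment> \<open>The expression is split into two brackets with weights
    \<open>1 - 2 * \<beta>\<close> and \<open>\<beta>\<close>, nonnegative because
    \<open>\<beta> \<le> 1 / 2\<close>, plus terms that are nonnegative because
    \<open>x > m\<close>. \<open>e0\<close> and \<open>e1\<close> make the brackets
    positive.\<close>
  have "L - b * (1 - \<beta> * (b + 2)) * J > 0"
  proof -
    have e0: "(b - 1) * m + n - 2 - b * J > 0"
    proof -
      have "b * J \<le> b * (2 * k + 1)" using J' b by (intro mult_left_mono) auto
      moreover have "(b - 1) * m + n - 2 - b * (2 * k + 1) = b * ((b - 1) * (k - 1) + l - 2)"
        unfolding n_eq m_def by (simp add: algebra_simps power2_eq_square power3_eq_cube)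
      moreover have "2 * 13 \<le> (b - 1) * (k - 1)" using b k by (intro mult_mono) auto
      ultimately show ?thesis using b l by (smt (verit) mult_pos_pos)
    qed
    have e1: "(2 * b - 1) * m - 2 - b * (n - 2) + b\<^sup>2 * J > 0"
    proof -
      have "b * b + 1 < m"
      proof -
        have "(b + 1) * (b + 1) \<le> (b + 1) * (k - 1)" using b k by (intro mult_left_mono) auto
        then show ?thesis using m_ge' b by (simp add: algebra_simps)
      qed
      moreover have "53 \<le> m" using m_ge k(1) by linarith
      ultimately have "0 < 2 * m - 2 - b * b" by linarith
      moreover have "2 * m \<le> (b - 1) * m" using b k m_ge by (intro mult_right_mono) auto
      ultimately have "0 < (b - 1) * m - 2 - b * b" by linarith
      moreover have "(2 * b - 1) * m - 2 - b * (n - 2) = (b - 1) * m - 2 - b * b"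
        unfolding n_eq by (simp add: algebra_simps)
      moreover have "b\<^sup>2 * J \<ge> 0" using J' by simp
      ultimately show ?thesis by linarith
    qed
    have "L - b * (1 - \<beta> * (b + 2)) * J
        = (1 - 2 * \<beta>) * ((b - 1) * m + n - 2 - b * J)
          + \<beta> * ((2 * b - 1) * m - 2 - b * (n - 2) + b\<^sup>2 * J)
          + (b - 1 + \<beta>) * (x - m) + \<beta>\<^sup>2 * n + \<beta> * (b + 1)"
      unfolding L_def by (simp add: algebra_simps power2_eq_square power3_eq_cube)
    moreover have "(1 - 2 * \<beta>) * ((b - 1) * m + n - 2 - b * J) \<ge> 0"
      using \<beta> e0 by simp
    moreover have "\<beta> * ((2 * b - 1) * m - 2 - b * (n - 2) + b\<^sup>2 * J) > 0"
      using \<beta> e1 by simp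
    moreover have "(b - 1 + \<beta>) * (x - m) \<ge> 0" "\<beta>\<^sup>2 * n \<ge> 0" "\<beta> * (b + 1) \<ge> 0"
      using b \<beta> xm m_ge k by (auto simp: n_eq)
    ultimately show ?thesis by linarith
  qed
  then have "\<beta> * (L - b * (1 - \<beta> * (b + 2)) * J) > 0" using \<beta> by simp
  moreover have "(1 - \<beta>) * \<gamma> * A > 0" using \<beta> b A by (simp add: \<gamma>_def)
  ultimately show False using neg c_nonneg by (simp add: J_def)
qed

end

section \<open>Comparison of the two ends of the family\<close>

text \<open>Over the common denominator the contributions of \<open>k\<close> cancel, leaving one
  term in \<open>\<beta>\<^sub>2 - \<beta>\<^sub>1\<close> and one in
  \<open>u\<^sub>1 - u\<^sub>2\<close>. The bound is uniform in \<open>c \<ge> C\<close>, so it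
  serves both fractions of \<open>S\<close> below.\<close>

lemma diff_scaled_inverse_le:
  fixes c :: real
  assumes "0 < C" "C \<le> c" "0 < \<beta>\<^sub>1" "\<beta>\<^sub>1 \<le> \<beta>\<^sub>2" "0 \<le> u\<^sub>2" "u\<^sub>2 \<le> u\<^sub>1" "0 \<le> k"
  shows "\<beta>\<^sub>2 / (c + \<beta>\<^sub>2 * (u\<^sub>2 + k)) - \<beta>\<^sub>1 / (c + \<beta>\<^sub>1 * (u\<^sub>1 + k))
    \<le> (\<beta>\<^sub>2 - \<beta>\<^sub>1) / C + \<beta>\<^sub>1 * \<beta>\<^sub>2 * (u\<^sub>1 - u\<^sub>2) / C\<^sup>2"
proof -
  define d\<^sub>1 where "d\<^sub>1 = c + \<beta>\<^sub>1 * (u\<^sub>1 + k)"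
  define d\<^sub>2 where "d\<^sub>2 = c + \<beta>\<^sub>2 * (u\<^sub>2 + k)"
  have d: "c \<le> d\<^sub>1" "C \<le> d\<^sub>1" "C \<le> d\<^sub>2" "0 < d\<^sub>1" "0 < d\<^sub>2" "0 < c"
    using assms by (auto simp: d\<^sub>1_def d\<^sub>2_def intro!: add_increasing2 add_pos_nonneg)
  have "\<beta>\<^sub>2 / d\<^sub>2 - \<beta>\<^sub>1 / d\<^sub>1 = (\<beta>\<^sub>2 * d\<^sub>1 - \<beta>\<^sub>1 * d\<^sub>2) / (d\<^sub>1 * d\<^sub>2)"
    using d by (simp add: diff_divide_eq_iff divide_diff_eq_iff mult.commute)
  also have "\<beta>\<^sub>2 * d\<^sub>1 - \<beta>\<^sub>1 * d\<^sub>2 = (\<beta>\<^sub>2 - \<beta>\<^sub>1) * c + \<beta>\<^sub>1 * \<beta>\<^sub>2 * (u\<^sub>1 - u\<^sub>2)"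
    by (simp add: d\<^sub>1_def d\<^sub>2_def algebra_simps)
  also have "((\<beta>\<^sub>2 - \<beta>\<^sub>1) * c + \<beta>\<^sub>1 * \<beta>\<^sub>2 * (u\<^sub>1 - u\<^sub>2)) / (d\<^sub>1 * d\<^sub>2)
      = (\<beta>\<^sub>2 - \<beta>\<^sub>1) * (c / (d\<^sub>1 * d\<^sub>2)) + \<beta>\<^sub>1 * \<beta>\<^sub>2 * (u\<^sub>1 - u\<^sub>2) / (d\<^sub>1 * d\<^sub>2)"
    by (simp add: add_divide_distrib)
  also have "\<dots> \<le> (\<beta>\<^sub>2 - \<beta>\<^sub>1) * (1 / C) + \<beta>\<^sub>1 * \<beta>\<^sub>2 * (u\<^sub>1 - u\<^sub>2) / C\<^sup>2"
  proof (intro add_mono mult_left_mono divide_left_mono)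
    have "c * C \<le> d\<^sub>1 * d\<^sub>2" using d assms by (intro mult_mono) auto
    then show "c / (d\<^sub>1 * d\<^sub>2) \<le> 1 / C"
      using d assms(1) by (simp add: divide_simps mult.commute)
    show "C\<^sup>2 \<le> d\<^sub>1 * d\<^sub>2"
      unfolding power2_eq_square using d assms by (intro mult_mono) auto
  qed (use assms d in auto)
  finally show ?thesis by (simp add: d\<^sub>1_def d\<^sub>2_def)
qed

context extremal_family
begin

text \<open>In the coordinate \<open>u\<close> with \<open>x = m + u \<beta>\<close>, the pole of \<open>F 1 \<beta>\<close> sits at \<open>u = -1\<close> for every \<open>\<beta>\<close>;
  there \<open>F 1 \<beta> x = E u \<beta>\<close> and \<open>F k \<beta> x = E u \<beta> - \<beta> * T u \<beta>\<close>.\<close>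

definition \<xi> where "\<xi> u \<beta> = \<beta> * (b + 1) / (m - 1 + \<beta> * (1 + u))"

text \<open>The form with \<open>m * u / (1 + u)\<close> makes \<open>b + 1 \<le> W u\<close>
  visible for \<open>u \<ge> 0\<close>; \<open>W_eq\<close> supplies the form with
  \<open>m / (1 + u)\<close>.\<close>

definition W where "W u = u + b + 1 + m * u / (1 + u)"

definition E where "E u \<beta> = \<beta> * (W u - \<xi> u \<beta>) - (b + 1)"

text \<open>\<open>\<beta> * S u \<beta>\<close> is the quotient part of \<open>F k \<beta>\<close>:
  the first fraction comes from the clique of size \<open>l\<close>, the second from the
  \<open>b * k + 1\<close> isolated vertices.\<close>

definition S where
  "S u \<beta> = \<beta> * k * (l / (m - l + 1 - k + \<beta> * (u + k)) + (b * k + 1) / (m - k + \<beta> * (u + k)))"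

definition T where "T u \<beta> = k - 1 + S u \<beta> - m / (1 + u) - \<xi> u \<beta>"

definition U where "U \<beta> = (r 1 \<beta> - m) / \<beta>"

lemma m_ge_num: "53 \<le> m" "8 * b + 9 \<le> m"
  using m_ge k by linarith+

lemma W_eq: "0 \<le> u \<Longrightarrow> W u = u + b + 1 + m - m / (1 + u)"
  by (simp add: W_def field_simps)

lemma F_1_eq:
  assumes "0 \<le> u" "0 < \<beta>"
  shows "F 1 \<beta> (m + u * \<beta>) = E u \<beta>"
proof -
  have d: "m + u * \<beta> - (M 1 - 1) - (1 - \<beta>) * 1 = \<beta> * (1 + u)"
    "m + u * \<beta> - (1 - \<beta>) * 1 = m - 1 + \<beta> * (1 + u)"
    by (simp_all add: M_1 algebra_simps)
  have "\<beta>\<^sup>2 * 1 * (M 1 / (\<beta> * (1 + u)) + (b * 1 + 1) / (m - 1 + \<beta> * (1 + u)))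
      = \<beta>\<^sup>2 * (m / (\<beta> * (1 + u))) + \<beta>\<^sup>2 * ((b + 1) / (m - 1 + \<beta> * (1 + u)))"
    by (simp add: M_1 distrib_left)
  also have "\<beta>\<^sup>2 * (m / (\<beta> * (1 + u))) = \<beta> * (m / (1 + u))"
    using assms by (simp add: power2_eq_square)
  also have "\<beta>\<^sup>2 * ((b + 1) / (m - 1 + \<beta> * (1 + u))) = \<beta> * \<xi> u \<beta>"
    by (simp add: \<xi>_def power2_eq_square)
  finally have "\<beta>\<^sup>2 * 1 * (M 1 / (\<beta> * (1 + u)) + (b * 1 + 1) / (m - 1 + \<beta> * (1 + u)))
      = \<beta> * (m / (1 + u)) + \<beta> * \<xi> u \<beta>" .
  then show ?thesis
    unfolding F_def quot_fun_def d E_def W_eq[OF assms(1)] by (simp add: M_1 algebra_simps)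
qed

lemma F_k_eq:
  assumes "0 \<le> u"
  shows "F k \<beta> (m + u * \<beta>) = E u \<beta> - \<beta> * T u \<beta>"
proof -
  have d: "m + u * \<beta> - (M k - 1) - (1 - \<beta>) * k = m - l + 1 - k + \<beta> * (u + k)"
    "m + u * \<beta> - (1 - \<beta>) * k = m - k + \<beta> * (u + k)"
    by (simp_all add: M_k algebra_simps)
  have "\<beta>\<^sup>2 * k * (M k / (m - l + 1 - k + \<beta> * (u + k)) + (b * k + 1) / (m - k + \<beta> * (u + k)))
      = \<beta> * S u \<beta>"
    by (simp add: M_k S_def power2_eq_square)
  then have "F k \<beta> (m + u * \<beta>)
      = m + u * \<beta> - (1 - \<beta>) * (k + l + (b * k + 1) - 1) - \<beta> * (k - 1) - \<beta> * S u \<beta>"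
    unfolding F_def quot_fun_def d by (simp add: M_k)
  also have "\<dots> = E u \<beta> - \<beta> * T u \<beta>"
    unfolding E_def T_def W_eq[OF assms] by (simp add: m_def algebra_simps)
  finally show ?thesis .
qed

lemma U_root:
  assumes "0 < \<beta>" "\<beta> < 1"
  shows "r 1 \<beta> = m + U \<beta> * \<beta>" "0 < U \<beta>" "E (U \<beta>) \<beta> = 0"
proof -
  show r: "r 1 \<beta> = m + U \<beta> * \<beta>" and U: "0 < U \<beta>"
    using m_less_r_1[OF assms] assms by (auto simp: U_def)
  show "E (U \<beta>) \<beta> = 0"
    using r_root(2)[of 1 \<beta>] F_1_eq[of "U \<beta>" \<beta>] U assms k r by simp
qed

text \<open>Since \<open>l + k \<le> m\<close>, the point \<open>r 1 \<beta>\<close> lies beyond the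
  poles of \<open>F k \<beta>\<close>, so the sign test applies there. At this point
  \<open>E\<close> vanishes and \<open>F k \<beta>\<close> reduces to
  \<open>- \<beta> * T\<close>.\<close>

lemma r_1_r_k_iff:
  assumes "0 < \<beta>" "\<beta> < 1"
  shows "r 1 \<beta> < r k \<beta> \<longleftrightarrow> 0 < T (U \<beta>) \<beta>" "r 1 \<beta> = r k \<beta> \<longleftrightarrow> T (U \<beta>) \<beta> = 0"
proof -
  have "(1 - \<beta>) * k \<le> k"
    using assms k by (simp add: mult_left_le_one_le)
  moreover have "l + k \<le> m"
    using m_ge k l by linarith
  ultimately have "M k - 1 + (1 - \<beta>) * k < r 1 \<beta>"
    using m_less_r_1[OF assms] by (simp add: M_k)
  then have "r 1 \<beta> < r k \<beta> \<longleftrightarrow> F k \<beta> (r 1 \<beta>) < 0" "r 1 \<beta> = r k \<beta> \<longleftrightarrow> F k \<beta> (r 1 \<beta>) = 0"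
    using less_r_iff[of k \<beta> "r 1 \<beta>"] assms k by auto
  moreover have "F k \<beta> (r 1 \<beta>) = - (\<beta> * T (U \<beta>) \<beta>)"
    using F_k_eq[of "U \<beta>" \<beta>] U_root[OF assms] by simp
  ultimately show "r 1 \<beta> < r k \<beta> \<longleftrightarrow> 0 < T (U \<beta>) \<beta>" "r 1 \<beta> = r k \<beta> \<longleftrightarrow> T (U \<beta>) \<beta> = 0"
    using assms by (auto simp: zero_less_mult_iff)
qed

section \<open>Monotonicity and continuity of the zero curve of \<open>E\<close>\<close>

lemma \<xi>_pos: "0 < \<beta> \<Longrightarrow> 0 \<le> u \<Longrightarrow> 0 < \<xi> u \<beta>"
  using b m_ge_num by (auto simp: \<xi>_def intro!: divide_pos_pos add_pos_nonneg)

lemma \<xi>_le: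
  assumes "0 < \<beta>" "\<beta> \<le> 1" "0 \<le> u"
  shows "\<xi> u \<beta> \<le> \<beta> * (b + 1) / (m - 1)" "\<xi> u \<beta> \<le> b + 1"
proof -
  show le: "\<xi> u \<beta> \<le> \<beta> * (b + 1) / (m - 1)"
    unfolding \<xi>_def using assms b m_ge_num
    by (intro divide_left_mono mult_pos_pos add_pos_nonneg) auto
  have "\<beta> * (b + 1) \<le> 1 * (b + 1)"
    using assms b by (intro mult_right_mono) auto
  also have "\<dots> \<le> (b + 1) * (m - 1)"
    using b m_ge_num mult_left_mono[of 1 "m - 1" "b + 1"] by simp
  finally have "\<beta> * (b + 1) / (m - 1) \<le> b + 1"
    using m_ge_num by (simp add: divide_le_eq)
  with le show "\<xi> u \<beta> \<le> b + 1" by simp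
qed

lemma \<xi>_strict_mono:
  assumes "0 < \<beta>\<^sub>1" "\<beta>\<^sub>1 < \<beta>\<^sub>2" "0 \<le> u\<^sub>2" "u\<^sub>2 \<le> u\<^sub>1"
  shows "\<xi> u\<^sub>1 \<beta>\<^sub>1 < \<xi> u\<^sub>2 \<beta>\<^sub>2"
proof -
  have eq: "\<xi> u \<beta> = (b + 1) / ((m - 1) / \<beta> + (1 + u))" if "0 < \<beta>" for u \<beta>
    using that by (simp add: \<xi>_def field_simps)
  have "(m - 1) / \<beta>\<^sub>2 < (m - 1) / \<beta>\<^sub>1"
    using assms m_ge_num by (intro divide_strict_left_mono) auto
  moreover have "0 < (m - 1) / \<beta>\<^sub>2"
    using assms m_ge_num by simp
  ultimately show ?thesis
    using assms b by (simp add: eq) (intro divide_strict_left_mono mult_pos_pos; simp)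
qed

lemma E_strict_mono_left:
  assumes "0 < \<beta>" "0 \<le> u" "u < v"
  shows "E u \<beta> < E v \<beta>"
proof -
  have "m / (1 + v) \<le> m / (1 + u)"
    using assms m_ge_num by (intro divide_left_mono mult_pos_pos) auto
  moreover have "\<xi> v \<beta> \<le> \<xi> u \<beta>"
    unfolding \<xi>_def using assms b m_ge_num
    by (intro divide_left_mono mult_pos_pos add_left_mono mult_left_mono add_pos_nonneg) auto
  ultimately have "W u - \<xi> u \<beta> < W v - \<xi> v \<beta>"
    using assms by (simp add: W_eq)
  then show ?thesis using assms(1) by (simp add: E_def)
qed

text \<open>Only the term \<open>\<beta> * \<xi> u \<beta>\<close> works against growth. Freezing
  its denominator at \<open>\<beta>\<^sub>1\<close> bounds its difference quotient by
  \<open>(\<beta>\<^sub>2 + \<beta>\<^sub>1) * (b + 1) / q\<close>, which is less than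
  \<open>b + 1 \<le> W u\<close>.\<close>

lemma E_strict_mono_right:
  assumes "0 \<le> u" "0 < \<beta>\<^sub>1" "\<beta>\<^sub>1 < \<beta>\<^sub>2" "\<beta>\<^sub>2 \<le> 1"
  shows "E u \<beta>\<^sub>1 < E u \<beta>\<^sub>2"
proof -
  define q where "q = m - 1 + \<beta>\<^sub>1 * (1 + u)"
  have q: "2 \<le> q" using assms m_ge_num by (auto simp: q_def intro!: add_increasing2)
  have "\<beta>\<^sub>2 * \<xi> u \<beta>\<^sub>2 \<le> \<beta>\<^sub>2 * (\<beta>\<^sub>2 * (b + 1) / q)"
    unfolding \<xi>_def q_def using assms b m_ge_num
    by (intro mult_left_mono divide_left_mono mult_pos_pos add_left_mono mult_right_mono
        add_pos_nonneg) auto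
  moreover have "\<beta>\<^sub>2 * (\<beta>\<^sub>2 * (b + 1) / q) - \<beta>\<^sub>1 * \<xi> u \<beta>\<^sub>1
      = (\<beta>\<^sub>2 - \<beta>\<^sub>1) * ((\<beta>\<^sub>2 + \<beta>\<^sub>1) * (b + 1) / q)"
    unfolding \<xi>_def q_def[symmetric] using q by (simp add: field_simps)
  moreover have "(\<beta>\<^sub>2 + \<beta>\<^sub>1) * (b + 1) / q < b + 1"
  proof -
    have "(\<beta>\<^sub>2 + \<beta>\<^sub>1) * (b + 1) < q * (b + 1)"
      using assms b q by (intro mult_strict_right_mono) auto
    then show ?thesis using q by (simp add: divide_less_eq mult.commute)
  qed
  moreover have "b + 1 \<le> W u"
    using assms m_ge_num by (simp add: W_def)
  ultimately have "\<beta>\<^sub>2 * \<xi> u \<beta>\<^sub>2 - \<beta>\<^sub>1 * \<xi> u \<beta>\<^sub>1 < (\<beta>\<^sub>2 - \<beta>\<^sub>1) * W u"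
    using assms(3) by (smt (verit) mult_strict_left_mono)
  then show ?thesis by (simp add: E_def algebra_simps)
qed

lemma less_U_iff:
  assumes "0 < \<beta>" "\<beta> < 1" "0 \<le> y"
  shows "y < U \<beta> \<longleftrightarrow> E y \<beta> < 0" "U \<beta> < y \<longleftrightarrow> 0 < E y \<beta>"
  using E_strict_mono_left[OF assms(1), of y "U \<beta>"] E_strict_mono_left[OF assms(1), of "U \<beta>" y]
    U_root[OF assms(1,2)] assms(3)
  by (cases y "U \<beta>" rule: linorder_cases; force)+

text \<open>\<open>E\<close> increases in both arguments, so its zero curve falls.\<close>

lemma U_strict_antimono:
  assumes "0 < \<beta>\<^sub>1" "\<beta>\<^sub>1 < \<beta>\<^sub>2" "\<beta>\<^sub>2 < 1"
  shows "U \<beta>\<^sub>2 < U \<beta>\<^sub>1"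
  using E_strict_mono_right[of "U \<beta>\<^sub>2" \<beta>\<^sub>1 \<beta>\<^sub>2] U_root[of \<beta>\<^sub>2] less_U_iff(1)[of \<beta>\<^sub>1 "U \<beta>\<^sub>2"] assms
  by simp

text \<open>By \<open>less_U_iff\<close>, for a fixed \<open>y \<ge> 0\<close> the relations
  \<open>y < U x\<close> and \<open>U x < y\<close> are sign conditions on \<open>E y x\<close>, and
  these are open in \<open>x\<close> because \<open>E y\<close> is continuous.\<close>

lemma isCont_U:
  assumes "0 < \<beta>" "\<beta> < 1"
  shows "isCont U \<beta>"
  unfolding isCont_def
proof (rule order_tendstoI)
  have ev: "\<forall>\<^sub>F x in at \<beta>. 0 < x \<and> x < 1"
    using assms by (auto intro!: eventually_conj order_tendstoD[OF tendsto_ident_at])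
  have cont: "(E y \<longlongrightarrow> E y \<beta>) (at \<beta>)" if "0 \<le> y" for y
  proof -
    have "m - 1 + \<beta> * (1 + y) > 0"
      using assms that m_ge_num by (intro add_pos_nonneg) auto
    then show ?thesis
      unfolding E_def \<xi>_def by (intro tendsto_intros) auto
  qed
  show "\<forall>\<^sub>F x in at \<beta>. y < U x" if y: "y < U \<beta>" for y
  proof (cases "0 \<le> y")
    case True
    then have "E y \<beta> < 0" using y less_U_iff assms by simp
    then have "\<forall>\<^sub>F x in at \<beta>. E y x < 0" using order_tendstoD(2)[OF cont[OF True]] by simp
    with ev show ?thesis by eventually_elim (use less_U_iff True in simp)
  next
    case False
    from ev show ?thesis by eventually_elim (use U_root(2) False in force)
  qed
  show "\<forall>\<^sub>F x in at \<beta>. U x < y" if y: "U \<beta> < y" for y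
  proof -
    have y0: "0 \<le> y" using U_root(2)[OF assms] y by simp
    then have "E y \<beta> > 0" using y less_U_iff assms by simp
    then have "\<forall>\<^sub>F x in at \<beta>. E y x > 0" using order_tendstoD(1)[OF cont[OF y0]] by simp
    with ev show ?thesis by eventually_elim (use less_U_iff y0 in simp)
  qed
qed

section \<open>Bounds for \<open>S\<close> and regions where \<open>T\<close> has a known
  sign\<close>

lemma pole_gaps: "m - l + 1 - k = b * (k - 1)" "b * (k - 1) \<le> m - k" "0 < b * (k - 1)" "0 < m - k"
  using b k l m_ge by (auto simp: m_def algebra_simps)

lemma isCont_T_U:
  assumes "0 < \<beta>" "\<beta> < 1"
  shows "isCont (\<lambda>\<beta>. T (U \<beta>) \<beta>) \<beta>"
proof -
  have U: "0 < U \<beta>" using U_root assms by simp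
  have "0 < m - 1 + \<beta> * (1 + U \<beta>)" "0 < b * (k - 1) + \<beta> * (U \<beta> + k)"
    "0 < m - k + \<beta> * (U \<beta> + k)"
    using U assms m_ge_num pole_gaps k by (auto intro!: add_pos_nonneg)
  then show ?thesis
    unfolding T_def S_def \<xi>_def pole_gaps(1) using U isCont_U[OF assms]
    by (intro continuous_intros) auto
qed

text \<open>From \<open>b \<ge> 3\<close> comes \<open>l + 1 \<le> 4 / 3 * b\<close>. The factor
  13/10 then absorbs the replacement of \<open>k\<close> by \<open>k - 1\<close> as soon as
  \<open>k \<ge> 14\<close>.\<close>

lemma S_weight_le: "k * (l + b * k + 1) \<le> 13 / 10 * (k - 1) * (b * (k - 1))"
proof -
  have "l + b * k + 1 \<le> b * (k + 4 / 3)"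
    using b l by (simp add: algebra_simps)
  then have "k * (l + b * k + 1) \<le> k * (b * (k + 4 / 3))"
    using k by (intro mult_left_mono) auto
  also have "\<dots> = b * (k * (k + 4 / 3))" by simp
  also have "\<dots> \<le> b * (13 / 10 * (k - 1) * (k - 1))"
  proof (intro mult_left_mono)
    have "0 \<le> (k - 14) * (9 * k + 8)" using k by (intro mult_nonneg_nonneg) auto
    then show "k * (k + 4 / 3) \<le> 13 / 10 * (k - 1) * (k - 1)"
      by (simp add: algebra_simps)
  qed (use b in auto)
  finally show ?thesis by (simp add: mult_ac)
qed

lemma S_le:
  assumes "0 < \<beta>" "0 \<le> u"
  shows "S u \<beta> \<le> 13 / 10 * \<beta> * (k - 1)"
proof -
  define C where "C = b * (k - 1)"
  note gaps = pole_gaps[folded C_def]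
  have c: "0 \<le> \<beta> * (u + k)" using assms k by simp
  have d: "0 < C + \<beta> * (u + k)" "0 < m - k + \<beta> * (u + k)"
    using c gaps(3,4) by linarith+
  have "l / (m - l + 1 - k + \<beta> * (u + k)) + (b * k + 1) / (m - k + \<beta> * (u + k))
      \<le> l / C + (b * k + 1) / C"
    unfolding gaps(1) using c d gaps(2-) l b k
    by (intro add_mono divide_left_mono mult_pos_pos) auto
  then have "S u \<beta> \<le> \<beta> * k * (l / C + (b * k + 1) / C)"
    unfolding S_def using assms k by (intro mult_left_mono) auto
  also have "\<dots> = \<beta> * (k * (l + b * k + 1) / C)"
    by (simp add: add_divide_distrib distrib_left mult.assoc)
  also have "\<dots> \<le> \<beta> * (13 / 10 * (k - 1))"
    using S_weight_le gaps(3) assms by (intro mult_left_mono) (auto simp: C_def divide_le_eq)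
  finally show ?thesis by (simp add: mult_ac)
qed

text \<open>For \<open>u < 1\<close> the term \<open>m / (1 + u)\<close> is at least
  \<open>m / 2\<close>, nearly \<open>2 * k\<close>, while \<open>k - 1 + S u \<beta>\<close> stays
  below it. Later uses read this as: \<open>T u \<beta> \<ge> 0\<close> forces
  \<open>u \<ge> 1\<close>.\<close>

lemma T_neg:
  assumes "0 < \<beta>" "\<beta> \<le> 1 / 2" "0 \<le> u" "u < 1"
  shows "T u \<beta> < 0"
proof -
  have "13 / 10 * \<beta> * (k - 1) \<le> 13 / 10 * (1 / 2) * (k - 1)"
    using assms k by (intro mult_mono) auto
  then have "S u \<beta> \<le> 13 / 20 * k - 13 / 20"
    using S_le[OF assms(1,3)] by simp
  moreover have "m / 2 \<le> m / (1 + u)"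
    using assms m_ge_num by (intro divide_left_mono) auto
  ultimately show ?thesis
    using m_ge k \<xi>_pos[OF assms(1,3)] unfolding T_def by linarith
qed

lemma T_pos:
  assumes "0 < \<beta>" "\<beta> \<le> 1" "0 \<le> u" "m \<le> (1 + u) * (k - 1)"
  shows "0 < T u \<beta>"
proof -
  have "m / (1 + u) \<le> k - 1"
    using assms by (simp add: divide_le_eq mult.commute)
  \<comment> \<open>The isolated-vertex fraction of \<open>S\<close> alone dominates
    \<open>\<xi>\<close>: its denominator is no larger, as \<open>\<beta> \<le> 1\<close>, and its
    numerator is no smaller. The clique fraction makes the inequality strict.\<close>
  moreover have "\<xi> u \<beta> < S u \<beta>"
  proof -
    have c: "0 \<le> \<beta> * (u + k)" using assms k by simp
    have "\<beta> * (k - 1) \<le> 1 * (k - 1)" using assms k by (intro mult_right_mono) auto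
    then have "\<xi> u \<beta> \<le> \<beta> * (b + 1) / (m - k + \<beta> * (u + k))"
      unfolding \<xi>_def using assms b c pole_gaps(4) m_ge_num
      by (intro divide_left_mono mult_pos_pos add_pos_nonneg) (auto simp: distrib_left right_diff_distrib)
    also have "\<dots> \<le> \<beta> * (k * (b * k + 1)) / (m - k + \<beta> * (u + k))"
    proof -
      have "b * 1 \<le> b * k" using b k by (intro mult_left_mono) auto
      then have "1 * (b + 1) \<le> k * (b * k + 1)" using b k by (intro mult_mono) auto
      then show ?thesis
        using assms c pole_gaps by (intro divide_right_mono mult_left_mono) auto
    qed
    also have "\<dots> = \<beta> * k * (0 + (b * k + 1) / (m - k + \<beta> * (u + k)))"
      by simp
    also have "\<dots> < S u \<beta>"
      unfolding S_def using assms c pole_gaps l k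
      by (intro mult_strict_left_mono add_strict_right_mono divide_pos_pos add_pos_nonneg) auto
    finally show ?thesis .
  qed
  ultimately show ?thesis unfolding T_def by simp
qed
end

section \<open>The single sign change of \<open>T\<close> along the zero curve of
  \<open>E\<close>\<close>

context extremal_family
begin

lemma W_minus_\<xi>_ge:
  assumes "1 \<le> u" "0 < \<beta>" "\<beta> \<le> 1"
  shows "m / 2 \<le> W u - \<xi> u \<beta>"
proof -
  have "m / (1 + u) \<le> m / 2"
    using assms m_ge_num by (intro divide_left_mono) auto
  then show ?thesis
    using \<xi>_le(2)[of \<beta> u] assms by (simp add: W_eq)
qed

text \<open>On the zero curve \<open>\<beta> = (b + 1) / (W u - \<xi> u \<beta>)\<close>, whose
  denominator is at least \<open>m / 2\<close>; hence \<open>\<beta>\<close> is of order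
  \<open>1 / k\<close>.\<close>

lemma E_root_le:
  assumes "E u \<beta> = 0" "1 \<le> u" "0 < \<beta>" "\<beta> \<le> 1"
  shows "\<beta> * (k - 1) \<le> 2"
proof -
  have "\<beta> * (m / 2) \<le> b + 1"
  proof -
    have "\<beta> * (m / 2) \<le> \<beta> * (W u - \<xi> u \<beta>)"
      using W_minus_\<xi>_ge[OF assms(2-4)] assms by (intro mult_left_mono) auto
    then show ?thesis using assms(1) by (simp add: E_def)
  qed
  moreover have "\<beta> * ((b + 1) * (k - 1)) \<le> \<beta> * m"
    using m_ge' assms by (intro mult_left_mono) auto
  ultimately have "(b + 1) * (\<beta> * (k - 1)) \<le> (b + 1) * 2" by (simp add: mult_ac)
  then show ?thesis by (rule mult_left_le_imp_le) (use b in simp)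
qed

text \<open>As \<open>\<beta>\<close> falls from \<open>\<beta>\<^sub>2\<close> to
  \<open>\<beta>\<^sub>1\<close>, \<open>U\<close> rises by \<open>\<delta>\<close>, so
  \<open>m / (1 + u)\<close> falls by \<open>g * \<delta>\<close> and \<open>\<xi>\<close> by
  \<open>\<eta>\<close>; both raise \<open>T\<close>. A fall of \<open>S\<close> is at most
  \<open>\<delta> / 5 + g * \<delta> / 10 + \<eta> / 10\<close>, which is less because
  \<open>g \<ge> 1\<close>. If \<open>m / (1 + U \<beta>\<^sub>1)\<close> is already at most
  \<open>k - 1\<close>, no comparison is made.\<close>

lemma T_pos_below:
  assumes "0 < \<beta>\<^sub>1" "\<beta>\<^sub>1 < \<beta>\<^sub>2" "\<beta>\<^sub>2 \<le> 1 / 2" and T: "0 \<le> T (U \<beta>\<^sub>2) \<beta>\<^sub>2"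
  shows "0 < T (U \<beta>\<^sub>1) \<beta>\<^sub>1"
proof (cases "m \<le> (1 + U \<beta>\<^sub>1) * (k - 1)")
  case True
  then show ?thesis using T_pos[of \<beta>\<^sub>1 "U \<beta>\<^sub>1"] U_root(2)[of \<beta>\<^sub>1] assms by simp
next
  case False
  define K where "K = k - 1"
  define u\<^sub>1 where "u\<^sub>1 = U \<beta>\<^sub>1"
  define u\<^sub>2 where "u\<^sub>2 = U \<beta>\<^sub>2"
  define \<delta> where "\<delta> = u\<^sub>1 - u\<^sub>2"
  define \<eta> where "\<eta> = \<xi> u\<^sub>2 \<beta>\<^sub>2 - \<xi> u\<^sub>1 \<beta>\<^sub>1"
  define g where "g = m / ((1 + u\<^sub>1) * (1 + u\<^sub>2))"
  have K: "13 \<le> K" "2 * b + 2 \<le> K" and m: "4 * K \<le> m" "(b + 1) * K < m" "m \<le> (b + 2) * K"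
    using k m_ge m_ge' m_le by (auto simp: K_def)
  have u2: "1 \<le> u\<^sub>2"
    using T_neg[of \<beta>\<^sub>2 "U \<beta>\<^sub>2"] U_root(2)[of \<beta>\<^sub>2] assms by (force simp: u\<^sub>2_def)
  have \<delta>: "0 < \<delta>"
    using U_strict_antimono[of \<beta>\<^sub>1 \<beta>\<^sub>2] assms by (simp add: \<delta>_def u\<^sub>1_def u\<^sub>2_def)
  then have u1: "1 \<le> u\<^sub>1" "u\<^sub>2 \<le> u\<^sub>1" using u2 by (auto simp: \<delta>_def)
  have \<eta>: "0 < \<eta>"
    using \<xi>_strict_mono[of \<beta>\<^sub>1 \<beta>\<^sub>2 u\<^sub>2 u\<^sub>1] assms u1 u2 by (simp add: \<eta>_def)
  \<comment> \<open>The failed case condition bounds \<open>(1 + u\<^sub>1) * K\<close> and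
    \<open>(1 + u\<^sub>2) * K\<close> by \<open>m\<close>; multiplying them and using
    \<open>m \<le> K * K\<close>, from \<open>b + 2 \<le> K\<close>, gives the claim.\<close>
  have g: "1 \<le> g"
  proof -
    have "(1 + u\<^sub>1) * K \<le> m" using False by (simp add: u\<^sub>1_def K_def)
    moreover have "(1 + u\<^sub>2) * K \<le> (1 + u\<^sub>1) * K"
      using u1 K by (intro mult_right_mono) auto
    ultimately have "(1 + u\<^sub>1) * K \<le> m" "(1 + u\<^sub>2) * K \<le> m"
      by linarith+
    then have "(1 + u\<^sub>1) * K * ((1 + u\<^sub>2) * K) \<le> m * m"
      using u1 u2 K m_ge_num by (intro mult_mono) auto
    moreover have "m \<le> K * K"
    proof -
      have "(b + 2) * K \<le> K * K" using K b by (intro mult_right_mono) auto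
      then show ?thesis using m(3) by linarith
    qed
    then have "(1 + u\<^sub>1) * (1 + u\<^sub>2) * m \<le> (1 + u\<^sub>1) * (1 + u\<^sub>2) * (K * K)"
      using u1 u2 by (intro mult_left_mono) auto
    ultimately have "(1 + u\<^sub>1) * (1 + u\<^sub>2) * m \<le> m * m"
      by (simp add: mult_ac)
    then have "(1 + u\<^sub>1) * (1 + u\<^sub>2) \<le> m"
      using m_ge_num by simp
    then show ?thesis
      using u1 u2 by (simp add: g_def le_divide_eq)
  qed
  have E: "\<beta>\<^sub>1 * (W u\<^sub>1 - \<xi> u\<^sub>1 \<beta>\<^sub>1) = b + 1" "\<beta>\<^sub>2 * (W u\<^sub>2 - \<xi> u\<^sub>2 \<beta>\<^sub>2) = b + 1"
    using U_root(3)[of \<beta>\<^sub>1] U_root(3)[of \<beta>\<^sub>2] assms by (auto simp: E_def u\<^sub>1_def u\<^sub>2_def)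
  have \<beta>: "\<beta>\<^sub>1 * K \<le> 2" "\<beta>\<^sub>2 * K \<le> 2"
    using E_root_le[of u\<^sub>1 \<beta>\<^sub>1] E_root_le[of u\<^sub>2 \<beta>\<^sub>2] E u1 u2 assms by (auto simp: E_def K_def)
  moreover have "\<beta>\<^sub>1 * 13 \<le> \<beta>\<^sub>1 * K" "\<beta>\<^sub>2 * 13 \<le> \<beta>\<^sub>2 * K"
    using K assms by (intro mult_left_mono; simp)+
  ultimately have \<beta>': "\<beta>\<^sub>1 \<le> 2 / 13" "\<beta>\<^sub>2 \<le> 2 / 13"
    by linarith+
  have W_diff: "W u\<^sub>1 - W u\<^sub>2 = \<delta> * (1 + g)"
  proof -
    have "m / (1 + u\<^sub>2) - m / (1 + u\<^sub>1) = \<delta> * g"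
      using u1 u2 by (simp add: g_def \<delta>_def field_simps)
    then show ?thesis
      using u1 u2 by (simp add: W_eq \<delta>_def algebra_simps)
  qed
  \<comment> \<open>Subtracting the two equations \<open>E\<close> gives the equality in the middle;
    \<open>W u\<^sub>2 - \<xi> u\<^sub>2 \<beta>\<^sub>2 \<ge> m / 2 \<ge> 2 * K\<close> gives the
    inequality.\<close>
  have \<Delta>: "2 * K * (\<beta>\<^sub>2 - \<beta>\<^sub>1) \<le> \<beta>\<^sub>1 * (\<delta> * (1 + g) + \<eta>)"
  proof -
    have "(\<beta>\<^sub>2 - \<beta>\<^sub>1) * (2 * K) \<le> (\<beta>\<^sub>2 - \<beta>\<^sub>1) * (W u\<^sub>2 - \<xi> u\<^sub>2 \<beta>\<^sub>2)"
      using W_minus_\<xi>_ge[of u\<^sub>2 \<beta>\<^sub>2] m u2 assms by (intro mult_left_mono) auto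
    also have "\<dots> = \<beta>\<^sub>1 * ((W u\<^sub>1 - W u\<^sub>2) + \<eta>)"
      using E by (simp add: \<eta>_def algebra_simps)
    finally show ?thesis by (simp add: W_diff mult.commute)
  qed
  have S_diff: "S u\<^sub>2 \<beta>\<^sub>2 - S u\<^sub>1 \<beta>\<^sub>1
      \<le> 13 / 10 * K * (\<beta>\<^sub>2 - \<beta>\<^sub>1) + 13 / 10 * (\<beta>\<^sub>1 * \<beta>\<^sub>2) * (\<delta> / b)"
  proof -
    define C where "C = b * K"
    \<comment> \<open>Both denominators of \<open>S\<close> have constant part at least
      \<open>C\<close>, so \<open>D\<close> bounds the growth of each scaled fraction.\<close>
    define D where "D = (\<beta>\<^sub>2 - \<beta>\<^sub>1) / C + \<beta>\<^sub>1 * \<beta>\<^sub>2 * \<delta> / C\<^sup>2"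
    have C: "0 < C" and D0: "0 \<le> D"
      using K b \<delta> assms by (auto simp: C_def D_def)
    have *: "\<beta>\<^sub>2 / (c + \<beta>\<^sub>2 * (u\<^sub>2 + k)) - \<beta>\<^sub>1 / (c + \<beta>\<^sub>1 * (u\<^sub>1 + k)) \<le> D" if "C \<le> c" for c
      unfolding D_def \<delta>_def using C that assms u1 u2 k
      by (intro diff_scaled_inverse_le) auto
    have split: "S u \<beta> = k * (l * (\<beta> / (m - l + 1 - k + \<beta> * (u + k)))
        + (b * k + 1) * (\<beta> / (m - k + \<beta> * (u + k))))" for u \<beta>
      unfolding S_def by (simp only: divide_inverse ring_distribs mult_ac add_ac mult_1_left)
    have "S u\<^sub>2 \<beta>\<^sub>2 - S u\<^sub>1 \<beta>\<^sub>1 =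
        k * (l * (\<beta>\<^sub>2 / (m - l + 1 - k + \<beta>\<^sub>2 * (u\<^sub>2 + k)) - \<beta>\<^sub>1 / (m - l + 1 - k + \<beta>\<^sub>1 * (u\<^sub>1 + k)))
        + (b * k + 1) * (\<beta>\<^sub>2 / (m - k + \<beta>\<^sub>2 * (u\<^sub>2 + k)) - \<beta>\<^sub>1 / (m - k + \<beta>\<^sub>1 * (u\<^sub>1 + k))))"
      unfolding split by (simp only: ring_distribs)
    also have "\<dots> \<le> k * (l * D + (b * k + 1) * D)"
      using * pole_gaps k b l
      by (intro mult_left_mono add_mono) (auto simp: C_def K_def)
    also have "\<dots> = k * (l + b * k + 1) * D" by (simp add: algebra_simps)
    also have "\<dots> \<le> 13 / 10 * K * C * D"
      using S_weight_le D0 by (intro mult_right_mono) (auto simp: C_def K_def)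
    also have "\<dots> = 13 / 10 * K * (\<beta>\<^sub>2 - \<beta>\<^sub>1) + 13 / 10 * (\<beta>\<^sub>1 * \<beta>\<^sub>2) * (\<delta> / b)"
    proof -
      have "C * D = (\<beta>\<^sub>2 - \<beta>\<^sub>1) + \<beta>\<^sub>1 * \<beta>\<^sub>2 * \<delta> / C"
        using C by (simp add: D_def distrib_left power2_eq_square)
      moreover have "K * (\<beta>\<^sub>1 * \<beta>\<^sub>2 * \<delta> / C) = \<beta>\<^sub>1 * \<beta>\<^sub>2 * (\<delta> / b)"
        using K by (simp add: C_def)
      ultimately show ?thesis by (simp add: distrib_left mult.assoc)
    qed
    finally show ?thesis .
  qed
  \<comment> \<open>The constant is \<open>13 / 10 * (1 / 2) * (2 / 13)\<close>, the half coming
    from \<open>\<Delta>\<close> and \<open>2 / 13\<close> from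
    \<open>\<beta>\<^sub>1 * K \<le> 2\<close> with \<open>K \<ge> 13\<close>.\<close>
  have e1: "13 / 10 * K * (\<beta>\<^sub>2 - \<beta>\<^sub>1) \<le> 1 / 10 * (\<delta> * (1 + g) + \<eta>)"
  proof -
    have "\<beta>\<^sub>1 * (\<delta> * (1 + g) + \<eta>) \<le> 2 / 13 * (\<delta> * (1 + g) + \<eta>)"
      using \<beta>' \<delta> \<eta> g by (intro mult_right_mono) auto
    then show ?thesis using \<Delta> by simp
  qed
  have e2: "13 / 10 * (\<beta>\<^sub>1 * \<beta>\<^sub>2) * (\<delta> / b) \<le> 1 / 10 * \<delta>"
  proof -
    have "\<beta>\<^sub>1 * \<beta>\<^sub>2 \<le> 2 / 13 * (2 / 13)" using \<beta>' assms by (intro mult_mono) auto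
    moreover have "\<delta> / b \<le> \<delta> / 1" using b \<delta> by (intro divide_left_mono) auto
    ultimately have le: "\<beta>\<^sub>1 * \<beta>\<^sub>2 * (\<delta> / b) \<le> 2 / 13 * (2 / 13) * (\<delta> / 1)"
      by (rule mult_mono) (use assms \<delta> b in auto)
    have "13 / 10 * (\<beta>\<^sub>1 * \<beta>\<^sub>2) * (\<delta> / b) = 13 / 10 * (\<beta>\<^sub>1 * \<beta>\<^sub>2 * (\<delta> / b))"
      by (simp only: mult.assoc)
    also have "\<dots> \<le> 13 / 10 * (2 / 13 * (2 / 13) * (\<delta> / 1))"
      using le by (intro mult_left_mono) auto
    also have "\<dots> \<le> 1 / 10 * \<delta>" using \<delta> by simp
    finally show ?thesis .
  qed
  have "m / (1 + u\<^sub>2) - m / (1 + u\<^sub>1) = g * \<delta>"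
    using W_diff u1 u2 by (simp add: W_eq \<delta>_def algebra_simps)
  then have "T u\<^sub>1 \<beta>\<^sub>1 - T u\<^sub>2 \<beta>\<^sub>2 = g * \<delta> + \<eta> - (S u\<^sub>2 \<beta>\<^sub>2 - S u\<^sub>1 \<beta>\<^sub>1)"
    by (simp add: T_def \<eta>_def)
  moreover have "1 / 10 * (\<delta> * (1 + g) + \<eta>) = \<delta> / 10 + g * \<delta> / 10 + \<eta> / 10"
    by (simp add: field_simps)
  then have "S u\<^sub>2 \<beta>\<^sub>2 - S u\<^sub>1 \<beta>\<^sub>1 \<le> \<delta> / 10 + g * \<delta> / 10 + \<eta> / 10 + 1 / 10 * \<delta>"
    using order_trans[OF S_diff add_mono[OF e1 e2]] by (simp only:)
  moreover have "\<delta> \<le> g * \<delta>" using g \<delta> by simp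
  ultimately have "0 < T u\<^sub>1 \<beta>\<^sub>1 - T u\<^sub>2 \<beta>\<^sub>2"
    using \<delta> \<eta> by linarith
  then show ?thesis using T by (simp add: u\<^sub>1_def u\<^sub>2_def)
qed

lemma crossing_exists:
  obtains \<beta>\<^sub>0 where "0 < \<beta>\<^sub>0" "\<beta>\<^sub>0 < 1 / 2" "T (U \<beta>\<^sub>0) \<beta>\<^sub>0 = 0"
proof -
  \<comment> \<open>\<open>W (b + 1) < m + 2 * b + 4\<close>, so this choice makes
    \<open>E (b + 1)\<close> negative. Then \<open>U \<beta>\<^sub>1 > b + 1\<close>, and
    \<open>m \<le> (b + 2) * (k - 1)\<close> brings \<open>T_pos\<close> into play.\<close>
  define \<beta>\<^sub>1 where "\<beta>\<^sub>1 = (b + 1) / (m + 2 * b + 4)"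
  have \<beta>1: "0 < \<beta>\<^sub>1" "\<beta>\<^sub>1 < 1 / 2"
    using b m_ge_num by (auto simp: \<beta>\<^sub>1_def divide_less_eq)
  have "E (b + 1) \<beta>\<^sub>1 < 0"
  proof -
    have "m / (1 + (b + 1)) > 0" using b m_ge_num by simp
    then have "W (b + 1) - \<xi> (b + 1) \<beta>\<^sub>1 < m + 2 * b + 4"
      using \<xi>_pos[of \<beta>\<^sub>1 "b + 1"] \<beta>1 b by (simp add: W_eq)
    then have "\<beta>\<^sub>1 * (W (b + 1) - \<xi> (b + 1) \<beta>\<^sub>1) < \<beta>\<^sub>1 * (m + 2 * b + 4)"
      using \<beta>1 by simp
    then show ?thesis using b m_ge_num by (simp add: E_def \<beta>\<^sub>1_def)
  qed
  then have "b + 1 < U \<beta>\<^sub>1" using less_U_iff(1)[of \<beta>\<^sub>1 "b + 1"] \<beta>1 b by simp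
  then have "(b + 2) * (k - 1) \<le> (1 + U \<beta>\<^sub>1) * (k - 1)"
    using k by (intro mult_right_mono) auto
  then have pos: "0 < T (U \<beta>\<^sub>1) \<beta>\<^sub>1"
    using T_pos[of \<beta>\<^sub>1 "U \<beta>\<^sub>1"] m_le \<beta>1 U_root(2)[of \<beta>\<^sub>1] by simp
  \<comment> \<open>At the other end \<open>U\<close> is below 1, where \<open>T_neg\<close>
    applies.\<close>
  have "0 < E 1 (1 / 2)"
    using \<xi>_le(2)[of "1 / 2" 1] m_ge_num by (simp add: E_def W_eq)
  then have "U (1 / 2) < 1" using less_U_iff(2)[of "1 / 2" 1] by simp
  then have neg: "T (U (1 / 2)) (1 / 2) < 0"
    using T_neg[of "1 / 2" "U (1 / 2)"] U_root(2)[of "1 / 2"] by simp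
  have "\<forall>x. \<beta>\<^sub>1 \<le> x \<and> x \<le> 1 / 2 \<longrightarrow> isCont (\<lambda>\<beta>. T (U \<beta>) \<beta>) x"
    using isCont_T_U \<beta>1 by simp
  then obtain \<beta>\<^sub>0 where \<beta>0: "\<beta>\<^sub>1 \<le> \<beta>\<^sub>0" "\<beta>\<^sub>0 \<le> 1 / 2" "T (U \<beta>\<^sub>0) \<beta>\<^sub>0 = 0"
    using IVT2[of "\<lambda>\<beta>. T (U \<beta>) \<beta>" "1 / 2" 0 \<beta>\<^sub>1] pos neg \<beta>1 by auto
  moreover have "\<beta>\<^sub>0 \<noteq> 1 / 2" using neg \<beta>0(3) by (metis less_irrefl)
  ultimately have "0 < \<beta>\<^sub>0" "\<beta>\<^sub>0 < 1 / 2" using \<beta>1 by linarith+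
  then show thesis using that \<beta>0(3) by blast
qed

text \<open>Eliminating \<open>u\<close> through \<open>m / (1 + u) = k - 1 + \<theta>\<close> turns
  the crossing into two equations whose auxiliary quantities have bounds depending on
  \<open>b\<close> only or are controlled by \<open>\<beta>\<close>.\<close>

lemma crossing_equations:
  assumes \<beta>: "0 < \<beta>" "\<beta> < 1 / 2" and T0: "T (U \<beta>) \<beta> = 0"
  obtains w x \<theta> where
    "\<beta> * (k - 1) \<le> 2" "0 \<le> w" "w \<le> b + 5" "0 \<le> x" "x \<le> \<beta>" "- 1 \<le> \<theta>" "\<theta> \<le> 3"
    "\<theta> = \<beta> * k * (l / (b * (k - 1) + w) + (b * k + 1) / (b * (k - 1) + l - 1 + w)) - x"
    "\<beta> * (((b + 1) * (k - 1) + l) / (k - 1 + \<theta>) + b + b * (k - 1) + l - \<theta>) = b + 1 + \<beta> * x"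
proof -
  define u where "u = U \<beta>"
  define x where "x = \<xi> u \<beta>"
  define w where "w = \<beta> * (u + k)"
  define \<theta> where "\<theta> = S u \<beta> - x"
  have u0: "0 < u" and E0: "E u \<beta> = 0" and T: "T u \<beta> = 0"
    using U_root[of \<beta>] \<beta> T0 by (auto simp: u_def)
  have u1: "1 \<le> u"
    using T_neg[of \<beta> u] \<beta> u0 T by force
  have \<beta>K: "\<beta> * (k - 1) \<le> 2"
    using E_root_le[OF E0 u1] \<beta> by simp
  have x0: "0 \<le> x"
    using \<xi>_pos[of \<beta> u] \<beta> u0 by (simp add: x_def)
  have x_le: "x \<le> \<beta>"
  proof -
    have "\<beta> * (b + 1) \<le> \<beta> * (m - 1)" using \<beta> m_ge_num b by (intro mult_left_mono) auto
    then have "\<beta> * (b + 1) / (m - 1) \<le> \<beta>" using m_ge_num by (simp add: divide_le_eq)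
    then show ?thesis using \<xi>_le(1)[of \<beta> u] \<beta> u0 by (simp add: x_def)
  qed
  have w0: "0 \<le> w" using \<beta> u0 k by (simp add: w_def)
  have \<theta>_eq: "\<theta> = \<beta> * k * (l / (b * (k - 1) + w) + (b * k + 1) / (b * (k - 1) + l - 1 + w)) - x"
  proof -
    have "m - k = b * (k - 1) + l - 1" by (simp add: m_def algebra_simps)
    then show ?thesis by (simp add: \<theta>_def S_def pole_gaps(1) w_def)
  qed
  have S0: "0 \<le> S u \<beta>"
    unfolding S_def pole_gaps(1) w_def[symmetric]
    using \<beta> k l b w0 pole_gaps(3,4) by (intro mult_nonneg_nonneg add_nonneg_nonneg divide_nonneg_nonneg) auto
  have \<theta>: "- 1 \<le> \<theta>" "\<theta> \<le> 3"
    using S0 S_le[of \<beta> u] \<beta> u0 \<beta>K x0 x_le by (simp_all add: \<theta>_def)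
  have y: "m / (1 + u) = k - 1 + \<theta>"
    using T by (simp add: T_def \<theta>_def x_def)
  then have y': "m / (k - 1 + \<theta>) = 1 + u"
    using u0 \<theta> k by (simp add: field_simps)
  \<comment> \<open>As \<open>\<theta> \<ge> - 1\<close>, the denominator
    \<open>k - 1 + \<theta>\<close> is at least half of \<open>k - 1\<close>, so
    \<open>1 + u \<le> 2 * b + 4\<close>; then split
    \<open>w = \<beta> * (u + 1) + \<beta> * (k - 1)\<close>.\<close>
  have "w \<le> b + 5"
  proof -
    have "(1 + u) * ((k - 1) / 2) \<le> (1 + u) * (k - 1 + \<theta>)"
      using u0 k \<theta> by (intro mult_left_mono) auto
    also have "\<dots> = m" using y' k \<theta> by (auto simp: field_simps)
    also have "m \<le> (2 * b + 4) * ((k - 1) / 2)"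
    proof -
      have "(2 * b + 4) * ((k - 1) / 2) = (b + 2) * (k - 1)" by (simp add: field_simps)
      then show ?thesis using m_le by (simp only:)
    qed
    finally have "1 + u \<le> 2 * b + 4" using k by (simp add: mult_le_cancel_right)
    then have "\<beta> * (u + 1) \<le> 1 / 2 * (2 * b + 4)" using \<beta> u0 by (intro mult_mono) auto
    then show ?thesis using \<beta>K by (simp add: w_def algebra_simps)
  qed
  moreover have "\<beta> * (((b + 1) * (k - 1) + l) / (k - 1 + \<theta>) + b + b * (k - 1) + l - \<theta>) = b + 1 + \<beta> * x"
  proof -
    have "W u = m / (k - 1 + \<theta>) + b + m - (k - 1 + \<theta>)"
      using u0 by (simp add: W_eq y y')
    then have "\<beta> * (m / (k - 1 + \<theta>) + b + m - (k - 1 + \<theta>)) = b + 1 + \<beta> * x"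
      using E0 by (simp add: E_def x_def right_diff_distrib)
    moreover have "m / (k - 1 + \<theta>) + b + m - (k - 1 + \<theta>)
        = ((b + 1) * (k - 1) + l) / (k - 1 + \<theta>) + b + b * (k - 1) + l - \<theta>"
      by (simp add: m_def algebra_simps)
    ultimately show ?thesis by simp
  qed
  ultimately show thesis
    using that[of w x \<theta>] \<beta>K w0 x0 x_le \<theta> \<theta>_eq by simp
qed

lemma r_crossing:
  obtains \<beta>\<^sub>0 where "0 < \<beta>\<^sub>0" "\<beta>\<^sub>0 < 1 / 2" "T (U \<beta>\<^sub>0) \<beta>\<^sub>0 = 0" "r 1 \<beta>\<^sub>0 = r k \<beta>\<^sub>0"
    "\<And>\<beta>. 0 < \<beta> \<Longrightarrow> \<beta> < \<beta>\<^sub>0 \<Longrightarrow> r 1 \<beta> < r k \<beta>"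
    "\<And>\<beta>. \<beta>\<^sub>0 < \<beta> \<Longrightarrow> \<beta> \<le> 1 / 2 \<Longrightarrow> r k \<beta> < r 1 \<beta>"
proof -
  obtain \<beta>\<^sub>0 where \<beta>0: "0 < \<beta>\<^sub>0" "\<beta>\<^sub>0 < 1 / 2" "T (U \<beta>\<^sub>0) \<beta>\<^sub>0 = 0"
    by (rule crossing_exists)
  show thesis
  proof (rule that[OF \<beta>0])
    show "r 1 \<beta>\<^sub>0 = r k \<beta>\<^sub>0"
      using r_1_r_k_iff(2)[of \<beta>\<^sub>0] \<beta>0 by simp
    show "r 1 \<beta> < r k \<beta>" if "0 < \<beta>" "\<beta> < \<beta>\<^sub>0" for \<beta>
      using r_1_r_k_iff(1)[of \<beta>] T_pos_below[of \<beta> \<beta>\<^sub>0] \<beta>0 that by simp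
    \<comment> \<open>By contraposition: \<open>T \<ge> 0\<close> at this larger
      \<open>\<beta>\<close> would make \<open>T\<close> positive at
      \<open>\<beta>\<^sub>0\<close>.\<close>
    show "r k \<beta> < r 1 \<beta>" if "\<beta>\<^sub>0 < \<beta>" "\<beta> \<le> 1 / 2" for \<beta>
      using r_1_r_k_iff[of \<beta>] T_pos_below[of \<beta>\<^sub>0 \<beta>] \<beta>0 that by force
  qed
qed

end

section \<open>Expansion of the crossing\<close>

lemma bigo_inverse_power_mult:
  fixes f g N :: "'a \<Rightarrow> real"
  assumes "f \<in> O[F](\<lambda>x. (1 / N x) ^ i)" "g \<in> O[F](\<lambda>x. (1 / N x) ^ j)"
  shows "(\<lambda>x. f x * g x) \<in> O[F](\<lambda>x. (1 / N x) ^ (i + j))"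
  using landau_o.big.mult[OF assms] by (simp add: power_add)

lemma bigo_inverse_power_mono:
  fixes f N :: "'a \<Rightarrow> real"
  assumes N: "\<forall>\<^sub>F x in F. 1 \<le> N x" and f: "f \<in> O[F](\<lambda>x. (1 / N x) ^ i)" and "j \<le> i"
  shows "f \<in> O[F](\<lambda>x. (1 / N x) ^ j)"
proof (rule landau_o.big_trans[OF f], rule bigoI[where c = 1])
  from N show "\<forall>\<^sub>F x in F. norm ((1 / N x) ^ i) \<le> 1 * norm ((1 / N x) ^ j)"
  proof eventually_elim
    case (elim x)
    then have "0 \<le> 1 / N x" "1 / N x \<le> 1" by auto
    then show ?case using power_decreasing[OF \<open>j \<le> i\<close>, of "1 / N x"] by simp
  qed
qed

text \<open>The equations \<open>E u \<beta> = 0\<close> and \<open>T u \<beta> = 0\<close> after eliminating \<open>u\<close> through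
  \<open>m / (1 + u) = K + \<theta>\<close>, where \<open>K = k - 1\<close>, \<open>x = \<xi> u \<beta>\<close>, \<open>w = \<beta> * (u + k)\<close> and \<open>\<theta> = S u \<beta> - x\<close>.
  The expansion only uses the bounds on \<open>w\<close>, \<open>x\<close> and \<open>\<theta>\<close>.\<close>

definition crossing_system ::
  "real \<Rightarrow> real \<Rightarrow> real \<Rightarrow> real \<Rightarrow> real \<Rightarrow> real \<Rightarrow> real \<Rightarrow> real \<Rightarrow> bool" where
  "crossing_system b K l N \<beta> w x \<theta> \<longleftrightarrow> 13 \<le> K \<and> 1 \<le> l \<and> l \<le> b \<and> N = (b + 1) * K + l + b + 2
      \<and> 0 < \<beta> \<and> \<beta> * K \<le> 2 \<and> 0 \<le> w \<and> w \<le> b + 5 \<and> 0 \<le> x \<and> x \<le> \<beta>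
      \<and> - 1 \<le> \<theta> \<and> \<theta> \<le> 3
      \<and> \<theta> = \<beta> * (K + 1) * (l / (b * K + w)
          + (b * (K + 1) + 1) / (b * K + l - 1 + w)) - x
      \<and> \<beta> * (((b + 1) * K + l) / (K + \<theta>) + b + b * K + l - \<theta>) = b + 1 + \<beta> * x"

lemma (in extremal_family) ex_crossing_system:
  assumes "0 < \<beta>" "\<beta> < 1 / 2" "T (U \<beta>) \<beta> = 0"
  shows "\<exists>w x \<theta>. crossing_system b (k - 1) l n \<beta> w x \<theta>"
proof -
  have "n = (b + 1) * (k - 1) + l + b + 2"
    by (simp add: n_def algebra_simps)
  then show ?thesis
    using crossing_equations[OF assms] assms(1) k l unfolding crossing_system_def
    by (smt (verit, best))
qed

text \<open>The bounds give \<open>\<beta> = O(1/N)\<close>. Feeding this back into the equations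
  determines \<open>\<beta> * K\<close> and \<open>\<theta>\<close> up to \<open>O(1/N)\<close>, and
  a second pass yields \<open>\<beta> * D = (b + 1)\<^sup>2 + O(N^-2)\<close> with
  \<open>D = b * N + e + O(1/N)\<close>.\<close>

lemma crossing_expansion:
  fixes b :: real and N K l \<beta> w x \<theta> :: "'a \<Rightarrow> real"
  assumes b: "3 \<le> b"
    and sys: "\<forall>\<^sub>F i in F. crossing_system b (K i) (l i) (N i) (\<beta> i) (w i) (x i) (\<theta> i)"
  shows "(\<lambda>i. \<beta> i - ((b + 1)\<^sup>2 / (b * N i)
      - (b + 1)\<^sup>2 * (b ^ 3 + b * l i - b - 1) / (b ^ 3 * (N i)\<^sup>2))) \<in> O[F](\<lambda>i. (1 / N i) ^ 3)"
proof -
  note ev = sys[unfolded crossing_system_def]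
  have N1: "\<forall>\<^sub>F i in F. 1 \<le> N i"
    using ev
  proof eventually_elim
    case (elim i)
    then have "0 \<le> (b + 1) * K i" using b by simp
    then show ?case using elim b by linarith
  qed
  have bK: "\<forall>\<^sub>F i in F. K i + 1 \<le> b * K i"
    using ev
  proof eventually_elim
    case (elim i)
    have "K i + 1 \<le> 3 * K i" using elim by simp
    also have "\<dots> \<le> b * K i" using b elim by (intro mult_right_mono) auto
    finally show ?case .
  qed
  note mult = bigo_inverse_power_mult[of _ F N]
  note mono = bigo_inverse_power_mono[OF N1]
  note add = sum_in_bigo(1) and diff = sum_in_bigo(2)
  have bounded: "f \<in> O[F](\<lambda>i. (1 / N i) ^ 0)" if "\<forall>\<^sub>F i in F. \<bar>f i\<bar> \<le> C" for f :: "'a \<Rightarrow> real" and C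
    using that by (intro bigoI[where c = C]) simp
  have const: "(\<lambda>_. c) \<in> O[F](\<lambda>i. (1 / N i) ^ 0)" for c :: real
    by (rule bounded[of _ "\<bar>c\<bar>"]) simp
  \<comment> \<open>The hypotheses give \<open>N \<le> 2 * (b + 2) * K\<close>, so whatever is at
    least \<open>K / 2\<close> has an inverse of order \<open>1 / N\<close>.\<close>
  have inv: "(\<lambda>i. c / f i) \<in> O[F](\<lambda>i. (1 / N i) ^ 1)"
    if "\<forall>\<^sub>F i in F. K i \<le> 2 * f i" for f :: "'a \<Rightarrow> real" and c :: real
  proof (rule bigoI[where c = "\<bar>c\<bar> * (4 * (b + 2))"])
    from that ev N1 show "\<forall>\<^sub>F i in F. norm (c / f i) \<le> \<bar>c\<bar> * (4 * (b + 2)) * norm ((1 / N i) ^ 1)"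
    proof eventually_elim
      case (elim i)
      have "(b + 3) * 2 \<le> (b + 3) * K i"
        using b elim by (intro mult_left_mono) auto
      then have "N i \<le> 2 * (b + 2) * K i"
        using elim by (simp add: algebra_simps)
      also have "\<dots> \<le> 2 * (b + 2) * (2 * f i)"
        using b elim by (intro mult_left_mono) auto
      finally have "N i \<le> 4 * (b + 2) * f i" by (simp add: algebra_simps)
      moreover have pos: "0 < f i" "0 < N i" using elim by linarith+
      ultimately have "1 / f i \<le> 4 * (b + 2) / N i"
        by (simp add: pos_divide_le_eq pos_le_divide_eq)
      then have "\<bar>c\<bar> * (1 / f i) \<le> \<bar>c\<bar> * (4 * (b + 2) / N i)"
        by (intro mult_left_mono) auto
      moreover have "norm (c / f i) = \<bar>c\<bar> * (1 / f i)"
        "\<bar>c\<bar> * (4 * (b + 2)) * norm ((1 / N i) ^ 1) = \<bar>c\<bar> * (4 * (b + 2) / N i)"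
        using pos by simp_all
      ultimately show ?case by (simp only:)
    qed
  qed
  have l: "l \<in> O[F](\<lambda>i. (1 / N i) ^ 0)"
    by (rule bounded[of _ b], use ev in eventually_elim) auto
  have w: "w \<in> O[F](\<lambda>i. (1 / N i) ^ 0)"
    by (rule bounded[of _ "b + 5"], use ev in eventually_elim) auto
  have \<theta>: "\<theta> \<in> O[F](\<lambda>i. (1 / N i) ^ 0)"
    by (rule bounded[of _ 3], use ev in eventually_elim) auto
  have \<beta>K: "(\<lambda>i. \<beta> i * K i) \<in> O[F](\<lambda>i. (1 / N i) ^ 0)"
    by (rule bounded[of _ 2], use ev in eventually_elim) auto
  have \<beta>: "\<beta> \<in> O[F](\<lambda>i. (1 / N i) ^ 1)"
  proof -
    have "(\<lambda>i. 2 / K i) \<in> O[F](\<lambda>i. (1 / N i) ^ 1)"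
      by (rule inv, use ev in eventually_elim) auto
    moreover have "\<beta> \<in> O[F](\<lambda>i. 2 / K i)"
    proof (rule bigoI[where c = 1], use ev in eventually_elim)
      case (elim i)
      then show ?case by (simp add: le_divide_eq)
    qed
    ultimately show ?thesis using landau_o.big_trans by blast
  qed
  have x: "x \<in> O[F](\<lambda>i. (1 / N i) ^ 1)"
  proof (rule landau_o.big_trans[OF _ \<beta>], rule bigoI[where c = 1])
    show "\<forall>\<^sub>F i in F. norm (x i) \<le> 1 * norm (\<beta> i)" using ev by eventually_elim auto
  qed
  \<comment> \<open>\<open>r\<^sub>1\<close>, \<open>r\<^sub>2\<close> and \<open>r\<^sub>3\<close>
    are the errors in the limits \<open>m / (K + \<theta>) = b + 1\<close>,
    \<open>b * \<beta> * K = b + 1\<close> and \<open>\<theta> = (b + 1) / b\<close>, each used in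
    proving the next or in \<open>D\<close>.\<close>
  define r\<^sub>1 where "r\<^sub>1 i = ((b + 1) * K i + l i) / (K i + \<theta> i) - (b + 1)" for i
  have r1_eq: "r\<^sub>1 i + (b + 1) = ((b + 1) * K i + l i) / (K i + \<theta> i)" for i
    by (simp add: r\<^sub>1_def)
  have r1: "r\<^sub>1 \<in> O[F](\<lambda>i. (1 / N i) ^ 1)"
  proof -
    have "(\<lambda>i. (l i - (b + 1) * \<theta> i) * (1 / (K i + \<theta> i))) \<in> O[F](\<lambda>i. (1 / N i) ^ (0 + 1))"
    proof (intro mult diff l inv)
      show "(\<lambda>i. (b + 1) * \<theta> i) \<in> O[F](\<lambda>i. (1 / N i) ^ 0)"
        using mult[OF const \<theta>] by simp
      show "\<forall>\<^sub>F i in F. K i \<le> 2 * (K i + \<theta> i)" using ev by eventually_elim auto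
    qed
    moreover have "\<forall>\<^sub>F i in F. r\<^sub>1 i = (l i - (b + 1) * \<theta> i) * (1 / (K i + \<theta> i))"
      using ev
    proof eventually_elim
      case (elim i)
      then have "K i + \<theta> i \<noteq> 0" by linarith
      then show ?case by (simp add: r\<^sub>1_def field_simps)
    qed
    ultimately show ?thesis using landau_o.big.in_cong by fastforce
  qed
  define r\<^sub>2 where "r\<^sub>2 i = b * (\<beta> i * K i) - (b + 1)" for i
  have r2: "r\<^sub>2 \<in> O[F](\<lambda>i. (1 / N i) ^ 1)"
  proof -
    have "(\<lambda>i. \<beta> i * (x i - (r\<^sub>1 i + (2 * b + 1) + l i - \<theta> i))) \<in> O[F](\<lambda>i. (1 / N i) ^ (1 + 0))"
      by (intro mult \<beta> diff add l \<theta> const mono[OF x] mono[OF r1]) auto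
    moreover have "\<forall>\<^sub>F i in F. r\<^sub>2 i = \<beta> i * (x i - (r\<^sub>1 i + (2 * b + 1) + l i - \<theta> i))"
      using ev
    proof eventually_elim
      case (elim i)
      have "\<beta> i * (r\<^sub>1 i + (b + 1) + b + b * K i + l i - \<theta> i) = b + 1 + \<beta> i * x i"
        unfolding r1_eq using elim by blast
      then show ?case by (simp add: r\<^sub>2_def algebra_simps)
    qed
    ultimately show ?thesis using landau_o.big.in_cong by fastforce
  qed
  define r\<^sub>3 where "r\<^sub>3 i = \<theta> i - (b + 1) / b" for i
  have r3: "r\<^sub>3 \<in> O[F](\<lambda>i. (1 / N i) ^ 1)"
  proof -
    \<comment> \<open>The bracket in the equation for \<open>\<theta>\<close> is
      \<open>1 + z\<close>, the leading 1 coming from \<open>b * K\<close> over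
      \<open>b * K\<close>.\<close>
    define z where "z i = l i * (1 / (b * K i + w i))
        + (b + 2 - l i - w i) * (1 / (b * K i + l i - 1 + w i))" for i
    have "z \<in> O[F](\<lambda>i. (1 / N i) ^ (0 + 1))"
      unfolding z_def
    proof (intro add mult l inv diff w const)
      show "\<forall>\<^sub>F i in F. K i \<le> 2 * (b * K i + w i)"
        using ev bK by eventually_elim auto
      show "\<forall>\<^sub>F i in F. K i \<le> 2 * (b * K i + l i - 1 + w i)"
        using ev bK by eventually_elim auto
    qed
    then have z: "z \<in> O[F](\<lambda>i. (1 / N i) ^ 1)" by simp
    have "(\<lambda>i. 1 / b * r\<^sub>2 i + \<beta> i + (\<beta> i * K i + \<beta> i) * z i - x i) \<in> O[F](\<lambda>i. (1 / N i) ^ 1)"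
    proof (intro diff add \<beta> x)
      show "(\<lambda>i. 1 / b * r\<^sub>2 i) \<in> O[F](\<lambda>i. (1 / N i) ^ 1)"
        using mult[OF const r2, of "1 / b"] by simp
      show "(\<lambda>i. (\<beta> i * K i + \<beta> i) * z i) \<in> O[F](\<lambda>i. (1 / N i) ^ 1)"
        using mult[OF add[OF \<beta>K mono[OF \<beta>, of 0]] z] by simp
    qed
    moreover have "\<forall>\<^sub>F i in F. r\<^sub>3 i = 1 / b * r\<^sub>2 i + \<beta> i + (\<beta> i * K i + \<beta> i) * z i - x i"
      using ev bK
    proof eventually_elim
      case (elim i)
      then have p: "0 < b * K i + w i" "0 < b * K i + l i - 1 + w i" by linarith+
      have "l i / (b * K i + w i) + (b * (K i + 1) + 1) / (b * K i + l i - 1 + w i) = 1 + z i"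
      proof -
        have "(b * (K i + 1) + 1) / (b * K i + l i - 1 + w i)
            = 1 + (b + 2 - l i - w i) * (1 / (b * K i + l i - 1 + w i))"
          using p(2) by (simp add: field_simps)
        then show ?thesis by (simp add: z_def)
      qed
      then have "\<theta> i = \<beta> i * (K i + 1) * (1 + z i) - x i" using elim by metis
      moreover have "1 / b * r\<^sub>2 i = \<beta> i * K i - (b + 1) / b"
        using b by (simp add: r\<^sub>2_def diff_divide_distrib)
      ultimately show ?case by (simp add: r\<^sub>3_def algebra_simps)
    qed
    ultimately show ?thesis using landau_o.big.in_cong by fastforce
  qed
  \<comment> \<open>Multiplying the second equation by \<open>b + 1\<close> and expressing
    \<open>(b + 1) * K\<close> through \<open>N\<close> produces \<open>D\<close>; \<open>e\<close>
    is its constant part once \<open>\<theta>\<close> is replaced by its limit.\<close>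
  define e where "e i = b\<^sup>2 - 1 + l i - 1 / b" for i
  define D where "D i = b * N i + e i + (b + 1) * (r\<^sub>1 i - r\<^sub>3 i)" for i
  \<comment> \<open>The first two terms of \<open>(b + 1)\<^sup>2 / (b * N + e)\<close>; they are
    the claimed ones because \<open>b ^ 3 + b * l - b - 1 = b * e\<close>.\<close>
  define t where "t i = (b + 1)\<^sup>2 / (b * N i) - (b + 1)\<^sup>2 * e i / (b\<^sup>2 * (N i)\<^sup>2)" for i
  have e: "e \<in> O[F](\<lambda>i. (1 / N i) ^ 0)"
    unfolding e_def by (intro add diff l const)
  have invN: "(\<lambda>i. c / N i) \<in> O[F](\<lambda>i. (1 / N i) ^ 1)" for c
    by (rule bigoI[where c = "\<bar>c\<bar>"]) (simp add: abs_mult divide_inverse)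
  have t: "t \<in> O[F](\<lambda>i. (1 / N i) ^ 1)"
  proof -
    have "(\<lambda>i. (b + 1)\<^sup>2 / b\<^sup>2 * e i * ((1 / N i) * (1 / N i))) \<in> O[F](\<lambda>i. (1 / N i) ^ (0 + 0 + (1 + 1)))"
      by (intro mult const e invN)
    then have "(\<lambda>i. (b + 1)\<^sup>2 / b\<^sup>2 * e i * ((1 / N i) * (1 / N i))) \<in> O[F](\<lambda>i. (1 / N i) ^ 1)"
      by (rule mono) simp
    then have "(\<lambda>i. (b + 1)\<^sup>2 / b / N i - (b + 1)\<^sup>2 / b\<^sup>2 * e i * ((1 / N i) * (1 / N i)))
        \<in> O[F](\<lambda>i. (1 / N i) ^ 1)"
      by (intro diff invN)
    then show ?thesis
      by (simp add: t_def[abs_def] power2_eq_square)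
  qed
  have D_eq: "\<forall>\<^sub>F i in F. \<beta> i * D i = (b + 1)\<^sup>2 + (b + 1) * (\<beta> i * x i)"
    using ev
  proof eventually_elim
    case (elim i)
    have "(b + 1) * (r\<^sub>1 i + (b + 1) + b + b * K i + l i - \<theta> i) = D i"
      using elim b by (simp add: D_def e_def r\<^sub>3_def field_simps power2_eq_square)
    moreover have "\<beta> i * (r\<^sub>1 i + (b + 1) + b + b * K i + l i - \<theta> i) = b + 1 + \<beta> i * x i"
      unfolding r1_eq using elim by blast
    ultimately have "\<beta> i * D i = (b + 1) * (b + 1 + \<beta> i * x i)"
      by (metis mult.left_commute)
    then show ?case by (simp add: power2_eq_square algebra_simps)
  qed
  \<comment> \<open>The three errors in \<open>(\<beta> - t) * D\<close> come from
    \<open>\<beta> * x\<close>, from truncating at \<open>t\<close>, and from replacing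
    \<open>D\<close> by \<open>b * N + e\<close>. Dividing by \<open>D\<close> gains the last
    order.\<close>
  have "(\<lambda>i. (b + 1) * (\<beta> i * x i) + (b + 1)\<^sup>2 / b\<^sup>2 * (e i * e i) * ((1 / N i) * (1 / N i))
      - (b + 1) * (t i * (r\<^sub>1 i - r\<^sub>3 i))) \<in> O[F](\<lambda>i. (1 / N i) ^ 2)"
  proof (intro diff add)
    have "(\<lambda>i. (b + 1) * (\<beta> i * x i)) \<in> O[F](\<lambda>i. (1 / N i) ^ (0 + (1 + 1)))"
      by (intro mult const \<beta> x)
    then show "(\<lambda>i. (b + 1) * (\<beta> i * x i)) \<in> O[F](\<lambda>i. (1 / N i) ^ 2)"
      by (rule mono) simp
    have "(\<lambda>i. (b + 1)\<^sup>2 / b\<^sup>2 * (e i * e i) * ((1 / N i) * (1 / N i)))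
        \<in> O[F](\<lambda>i. (1 / N i) ^ (0 + (0 + 0) + (1 + 1)))"
      by (intro mult const e invN)
    then show "(\<lambda>i. (b + 1)\<^sup>2 / b\<^sup>2 * (e i * e i) * ((1 / N i) * (1 / N i))) \<in> O[F](\<lambda>i. (1 / N i) ^ 2)"
      by (rule mono) simp
    have "(\<lambda>i. (b + 1) * (t i * (r\<^sub>1 i - r\<^sub>3 i))) \<in> O[F](\<lambda>i. (1 / N i) ^ (0 + (1 + 1)))"
      by (intro mult const t diff r1 r3)
    then show "(\<lambda>i. (b + 1) * (t i * (r\<^sub>1 i - r\<^sub>3 i))) \<in> O[F](\<lambda>i. (1 / N i) ^ 2)"
      by (rule mono) simp
  qed
  moreover have "\<forall>\<^sub>F i in F. (\<beta> i - t i) * D i = (b + 1) * (\<beta> i * x i)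
      + (b + 1)\<^sup>2 / b\<^sup>2 * (e i * e i) * ((1 / N i) * (1 / N i)) - (b + 1) * (t i * (r\<^sub>1 i - r\<^sub>3 i))"
    using D_eq N1
  proof eventually_elim
    case (elim i)
    have "t i * (b * N i + e i) = (b + 1)\<^sup>2 - (b + 1)\<^sup>2 / b\<^sup>2 * (e i * e i) * ((1 / N i) * (1 / N i))"
      using elim b by (simp add: t_def field_simps power2_eq_square)
    then have "t i * D i = (b + 1)\<^sup>2 - (b + 1)\<^sup>2 / b\<^sup>2 * (e i * e i) * ((1 / N i) * (1 / N i))
        + (b + 1) * (t i * (r\<^sub>1 i - r\<^sub>3 i))"
      by (simp add: D_def distrib_left)
    then show ?case using elim by (simp add: left_diff_distrib)
  qed
  ultimately have num: "(\<lambda>i. (\<beta> i - t i) * D i) \<in> O[F](\<lambda>i. (1 / N i) ^ 2)"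
    using landau_o.big.in_cong by fastforce
  have D_ge: "\<forall>\<^sub>F i in F. K i \<le> 2 * D i"
    using ev bK
  proof eventually_elim
    case (elim i)
    have "((b + 1) * K i + l i) / (K i + \<theta> i) \<ge> 0" using elim b by simp
    then have "D i \<ge> (b + 1) * (b + b * K i + l i - \<theta> i)"
    proof -
      have "D i = (b + 1) * (r\<^sub>1 i + (b + 1) + b + b * K i + l i - \<theta> i)"
        using elim b by (simp add: D_def e_def r\<^sub>3_def field_simps power2_eq_square)
      also have "\<dots> \<ge> (b + 1) * (b + b * K i + l i - \<theta> i)"
        using \<open>((b + 1) * K i + l i) / (K i + \<theta> i) \<ge> 0\<close> b
        by (intro mult_left_mono) (auto simp: r\<^sub>1_def)
      finally show ?thesis .
    qed
    moreover have "1 * (b + b * K i + l i - \<theta> i) \<le> (b + 1) * (b + b * K i + l i - \<theta> i)"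
      using b elim by (intro mult_right_mono) auto
    ultimately have "1 * (b + b * K i + l i - \<theta> i) \<le> D i"
      by (rule order_trans[rotated])
    then show ?case using b elim by auto
  qed
  have "(\<lambda>i. (\<beta> i - t i) * D i * (1 / D i)) \<in> O[F](\<lambda>i. (1 / N i) ^ (2 + 1))"
    by (intro mult num inv D_ge)
  moreover have "\<forall>\<^sub>F i in F. \<beta> i - ((b + 1)\<^sup>2 / (b * N i)
      - (b + 1)\<^sup>2 * (b ^ 3 + b * l i - b - 1) / (b ^ 3 * (N i)\<^sup>2)) = (\<beta> i - t i) * D i * (1 / D i)"
    using D_ge ev
  proof eventually_elim
    case (elim i)
    then have "D i \<noteq> 0" by linarith
    moreover have "b ^ 3 + b * l i - b - 1 = b * e i"
      using b by (simp add: e_def field_simps power2_eq_square power3_eq_cube)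
    then have "(b + 1)\<^sup>2 * (b ^ 3 + b * l i - b - 1) / (b ^ 3 * (N i)\<^sup>2)
        = (b + 1)\<^sup>2 * e i / (b\<^sup>2 * (N i)\<^sup>2)"
      using b by (simp add: power2_eq_square power3_eq_cube mult_ac)
    ultimately show ?case by (simp add: t_def)
  qed
  ultimately show ?thesis
    by (subst landau_o.big.in_cong) (auto simp: numeral_3_eq_3)
qed

section \<open>Extremal graphs\<close>

lemma G_fam_eq: "G_fam b n s = split_graph s (n - (b + 1) * s - 1) (b * s + 1)"
  by (simp add: G_fam_def split_graph_def)

text \<open>Parity enters here: \<open>b + 1\<close> and \<open>n\<close> are even, so the remainder
  of \<open>n - 2\<close> modulo \<open>b + 1\<close> is even and differs from \<open>b\<close>.
  Hence \<open>ell b n\<close>, one more than the remainder, is at most \<open>b\<close>.\<close>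

lemma extremal_family_parameters:
  assumes "3 \<le> b" "odd b" "even n" "N_min b \<le> n"
  shows "extremal_family (real b) (real (k_max b n)) (real (ell b n))"
    and "n = (b + 1) * k_max b n + ell b n + 1"
proof -
  define q where "q = (n - 2) mod (b + 1)"
  have "(b + 1) * max (2 * b + 3) 14 \<le> n - 2"
    using assms(4) by (simp add: N_min_def)
  then have "(b + 1) * max (2 * b + 3) 14 div (b + 1) \<le> k_max b n"
    unfolding k_max_def by (rule div_le_mono)
  moreover have "(b + 1) * max (2 * b + 3) 14 div (b + 1) = max (2 * b + 3) 14"
    by (rule nonzero_mult_div_cancel_left) simp
  ultimately have "max (2 * b + 3) 14 \<le> k_max b n"
    by (simp only:)
  then have k: "2 * b + 3 \<le> k_max b n" "14 \<le> k_max b n" by auto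
  have n2: "2 \<le> n" using assms(4) by (simp add: N_min_def)
  have n: "n = (b + 1) * k_max b n + q + 2"
    using n2 mult_div_mod_eq[of "b + 1" "n - 2"] by (simp add: k_max_def q_def)
  define c where "c = (b + 1) * k_max b n"
  have c: "n = c + q + 2" using n unfolding c_def .
  have "even c" using assms(2) by (simp add: c_def)
  then have "even q" using assms(3) unfolding c by simp
  then have "q \<noteq> b" using assms(2) by auto
  moreover have "q < b + 1" by (simp add: q_def)
  ultimately have "q < b" by simp
  moreover have ell: "ell b n = q + 1"
    unfolding ell_def c_def[symmetric] using c by linarith
  ultimately have "real 3 \<le> real b" "real 14 \<le> real (k_max b n)"
    "real (2 * b + 3) \<le> real (k_max b n)" "real 1 \<le> real (ell b n)" "real (ell b n) \<le> real b"
    unfolding of_nat_le_iff using assms(1) k by linarith+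
  then show "extremal_family (real b) (real (k_max b n)) (real (ell b n))"
    by unfold_locales simp_all
  show "n = (b + 1) * k_max b n + ell b n + 1"
    unfolding c_def[symmetric] using c ell by linarith
qed

lemma rho_G_fam:
  assumes "3 \<le> b" "odd b" "even n" "N_min b \<le> n" and s: "1 \<le> s" "s \<le> k_max b n"
    and \<beta>: "0 < \<beta>" "\<beta> < 1"
  shows "rho (1 - \<beta>) (G_fam b n s)
    = extremal_family.r (real b) (real (k_max b n)) (real (ell b n)) (real s) \<beta>"
proof -
  interpret extremal_family "real b" "real (k_max b n)" "real (ell b n)"
    by (rule extremal_family_parameters(1)[OF assms(1-4)])
  define m' where "m' = (b + 1) * (k_max b n - s) + ell b n"
  have "(b + 1) * k_max b n = (b + 1) * (k_max b n - s) + (b + 1) * s"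
    by (simp only: distrib_left[symmetric] le_add_diff_inverse2[OF s(2)])
  then have m': "n - (b + 1) * s - 1 = m'"
    using extremal_family_parameters(2)[OF assms(1-4)] unfolding m'_def by linarith
  have M: "real m' = M (real s)"
    unfolding m'_def M_def by (simp only: of_nat_add of_nat_mult of_nat_1 of_nat_diff[OF s(2)])
  have "1 \<le> m'" using l by (simp add: m'_def)
  then have "rho (1 - \<beta>) (split_graph s m' (b * s + 1)) = r (real s) \<beta>"
    using r_root[of "real s" \<beta>] s \<beta>
    by (intro rho_split_graph_root) (simp_all add: M F_def add.commute)
  then show ?thesis unfolding G_fam_eq m' .
qed

lemma argmax_at_ends:
  fixes f :: "nat \<Rightarrow> real"
  assumes k: "1 < k" and interior: "\<And>j. 1 < j \<Longrightarrow> j < k \<Longrightarrow> f j < max (f 1) (f k)"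
  shows "{j. j \<in> {1..k} \<and> f j = (MAX s\<in>{1..k}. f s)}
    = (if f k < f 1 then {1} else if f 1 < f k then {k} else {1, k})"
proof -
  have le: "f j \<le> max (f 1) (f k)" if "j \<in> {1..k}" for j
    using that interior[of j] by (cases "j = 1 \<or> j = k") auto
  have "(MAX s\<in>{1..k}. f s) = max (f 1) (f k)"
    using le k by (intro Max_eqI) (auto simp: max_def)
  moreover have "j \<in> {1..k} \<and> f j = max (f 1) (f k)
      \<longleftrightarrow> j = 1 \<and> f k \<le> f 1 \<or> j = k \<and> f 1 \<le> f k" for j
  proof (cases "j = 1 \<or> j = k \<or> j \<notin> {1..k}")
    case True
    then show ?thesis using k by (auto simp: max_def)
  next
    case False
    then show ?thesis using interior[of j] by auto
  qed
  ultimately show ?thesis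
    by auto
qed

lemma extremal_G_fam:
  assumes "3 \<le> b" "odd b" "even n" "N_min b \<le> n" and \<alpha>: "1 / 2 < \<alpha>" "\<alpha> < 1"
  shows "{j. extremal \<alpha> (G_fam b n) (k_max b n) j} =
    (if rho \<alpha> (G_fam b n (k_max b n)) < rho \<alpha> (G_fam b n 1) then {1}
     else if rho \<alpha> (G_fam b n 1) < rho \<alpha> (G_fam b n (k_max b n)) then {k_max b n}
     else {1, k_max b n})"
  unfolding extremal_def
proof (rule argmax_at_ends)
  interpret extremal_family "real b" "real (k_max b n)" "real (ell b n)"
    by (rule extremal_family_parameters(1)[OF assms(1-4)])
  show k1: "1 < k_max b n" using k by linarith
  show "rho \<alpha> (G_fam b n j) < max (rho \<alpha> (G_fam b n 1)) (rho \<alpha> (G_fam b n (k_max b n)))"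
    if "1 < j" "j < k_max b n" for j
    using interior_less[of "1 - \<alpha>" "real j"] \<alpha> that k1
      rho_G_fam[OF assms(1-4), of j "1 - \<alpha>"] rho_G_fam[OF assms(1-4), of 1 "1 - \<alpha>"]
      rho_G_fam[OF assms(1-4), of "k_max b n" "1 - \<alpha>"]
    by simp
qed

text \<open>Passing to \<open>\<beta> = 1 - \<alpha>\<close> reverses the order, so
  \<open>\<alpha>\<close> below the crossing corresponds to \<open>\<beta>\<close> above
  \<open>\<beta>\<^sub>0\<close>. The last claim feeds the expansion.\<close>

lemma alpha_star_properties:
  assumes "3 \<le> b" "odd b" "even n" "N_min b \<le> n"
  defines "\<alpha>\<^sub>0 \<equiv> alpha_star b n"
  shows "crossing b n \<alpha> \<longleftrightarrow> \<alpha> = \<alpha>\<^sub>0"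
    and "1 / 2 < \<alpha> \<Longrightarrow> \<alpha> < \<alpha>\<^sub>0 \<Longrightarrow> rho \<alpha> (G_fam b n (k_max b n)) < rho \<alpha> (G_fam b n 1)"
    and "\<alpha>\<^sub>0 < \<alpha> \<Longrightarrow> \<alpha> < 1 \<Longrightarrow> rho \<alpha> (G_fam b n 1) < rho \<alpha> (G_fam b n (k_max b n))"
    and "\<exists>w x \<theta>. crossing_system (real b) (real (k_max b n) - 1) (real (ell b n)) (real n)
      (1 - \<alpha>\<^sub>0) w x \<theta>"
proof -
  interpret extremal_family "real b" "real (k_max b n)" "real (ell b n)"
    by (rule extremal_family_parameters(1)[OF assms(1-4)])
  obtain \<beta>\<^sub>0 where \<beta>0: "0 < \<beta>\<^sub>0" "\<beta>\<^sub>0 < 1 / 2" "T (U \<beta>\<^sub>0) \<beta>\<^sub>0 = 0"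
      "r 1 \<beta>\<^sub>0 = r (real (k_max b n)) \<beta>\<^sub>0"
    and above: "\<And>\<beta>. 0 < \<beta> \<Longrightarrow> \<beta> < \<beta>\<^sub>0 \<Longrightarrow> r 1 \<beta> < r (real (k_max b n)) \<beta>"
    and below: "\<And>\<beta>. \<beta>\<^sub>0 < \<beta> \<Longrightarrow> \<beta> \<le> 1 / 2 \<Longrightarrow> r (real (k_max b n)) \<beta> < r 1 \<beta>"
    using r_crossing by blast
  have "1 \<le> k_max b n" using k by linarith
  then have rho: "rho \<alpha> (G_fam b n 1) = r 1 (1 - \<alpha>)"
    "rho \<alpha> (G_fam b n (k_max b n)) = r (real (k_max b n)) (1 - \<alpha>)" if "1 / 2 < \<alpha>" "\<alpha> < 1" for \<alpha>
    using rho_G_fam[OF assms(1-4), of 1 "1 - \<alpha>"]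
      rho_G_fam[OF assms(1-4), of "k_max b n" "1 - \<alpha>"] that by simp_all
  have cr: "crossing b n \<alpha> \<longleftrightarrow> \<alpha> = 1 - \<beta>\<^sub>0" for \<alpha>
  proof
    assume "crossing b n \<alpha>"
    then have \<alpha>: "1 / 2 < \<alpha>" "\<alpha> < 1" "r 1 (1 - \<alpha>) = r (real (k_max b n)) (1 - \<alpha>)"
      using rho by (auto simp: crossing_def)
    then show "\<alpha> = 1 - \<beta>\<^sub>0"
      using above[of "1 - \<alpha>"] below[of "1 - \<alpha>"]
      by (cases "1 - \<alpha>" \<beta>\<^sub>0 rule: linorder_cases) auto
  next
    assume "\<alpha> = 1 - \<beta>\<^sub>0"
    then show "crossing b n \<alpha>" using rho[of \<alpha>] \<beta>0 by (auto simp: crossing_def)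
  qed
  have \<alpha>0: "\<alpha>\<^sub>0 = 1 - \<beta>\<^sub>0"
    unfolding \<alpha>\<^sub>0_def alpha_star_def by (rule the_equality) (simp_all add: cr)
  show "crossing b n \<alpha> \<longleftrightarrow> \<alpha> = \<alpha>\<^sub>0" by (simp add: cr \<alpha>0)
  show "rho \<alpha> (G_fam b n (k_max b n)) < rho \<alpha> (G_fam b n 1)" if "1 / 2 < \<alpha>" "\<alpha> < \<alpha>\<^sub>0"
    using that rho[of \<alpha>] below[of "1 - \<alpha>"] \<beta>0 by (simp add: \<alpha>0)
  show "rho \<alpha> (G_fam b n 1) < rho \<alpha> (G_fam b n (k_max b n))" if "\<alpha>\<^sub>0 < \<alpha>" "\<alpha> < 1"
    using that rho[of \<alpha>] above[of "1 - \<alpha>"] \<beta>0 by (simp add: \<alpha>0)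
  have "real n = extremal_family.n (real b) (real (k_max b n)) (real (ell b n))"
    by (subst extremal_family_parameters(2)[OF assms(1-4)]) (simp add: n_def distrib_right)
  then show "\<exists>w x \<theta>. crossing_system (real b) (real (k_max b n) - 1) (real (ell b n)) (real n)
      (1 - \<alpha>\<^sub>0) w x \<theta>"
    using ex_crossing_system[OF \<beta>0(1-3)] by (simp add: \<alpha>0)
qed

lemma alpha_star_expansion:
  assumes "3 \<le> b" "odd b"
  shows "(\<lambda>n. alpha_star b n
      - (1 - (real b + 1)^2 / (real b * real n)
         + (real b + 1)^2 * (real b ^ 3 + real b * real (ell b n) - real b - 1)
             / (real b ^ 3 * real n ^ 2)))
    \<in> O[inf at_top (principal {n. even n})](\<lambda>n. 1 / real n ^ 3)"
    (is "?f \<in> O[?F](_)")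
proof -
  let ?sys = "\<lambda>n. crossing_system (real b) (real (k_max b n) - 1) (real (ell b n)) (real n)
    (1 - alpha_star b n)"
  \<comment> \<open>The witnesses are chosen as functions of \<open>n\<close>; the guard stays
    inside the quantifiers so that the choice covers all \<open>n\<close>.\<close>
  have "\<forall>n. \<exists>w x \<theta>. even n \<and> N_min b \<le> n \<longrightarrow> ?sys n w x \<theta>"
    using alpha_star_properties(4)[OF assms] by blast
  from choice[OF this] obtain w where "\<forall>n. \<exists>x \<theta>. even n \<and> N_min b \<le> n \<longrightarrow> ?sys n (w n) x \<theta>" ..
  from choice[OF this] obtain x where "\<forall>n. \<exists>\<theta>. even n \<and> N_min b \<le> n \<longrightarrow> ?sys n (w n) (x n) \<theta>" ..
  from choice[OF this] obtain \<theta> where sys: "\<forall>n. even n \<and> N_min b \<le> n \<longrightarrow> ?sys n (w n) (x n) (\<theta> n)" ..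
  have "\<forall>\<^sub>F n in ?F. ?sys n (w n) (x n) (\<theta> n)"
    unfolding eventually_inf_principal
    using eventually_ge_at_top[of "N_min b"] by eventually_elim (use sys in auto)
  then have "(\<lambda>n. (1 - alpha_star b n) - ((real b + 1)\<^sup>2 / (real b * real n)
      - (real b + 1)\<^sup>2 * (real b ^ 3 + real b * real (ell b n) - real b - 1)
          / (real b ^ 3 * (real n)\<^sup>2))) \<in> O[?F](\<lambda>n. (1 / real n) ^ 3)"
    using assms(1) by (intro crossing_expansion) auto
  moreover have "?f n = - ((1 - alpha_star b n) - ((real b + 1)\<^sup>2 / (real b * real n)
      - (real b + 1)\<^sup>2 * (real b ^ 3 + real b * real (ell b n) - real b - 1)
          / (real b ^ 3 * (real n)\<^sup>2)))" for n
    by simp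
  ultimately show ?thesis
    by (simp only: landau_o.big.uminus_in_iff power_one_over)
qed

theorem theorem1p2:
  fixes b :: nat
  assumes "b \<ge> 3" and "odd b"
  shows "(\<forall>n. even n \<and> n \<ge> N_min b \<longrightarrow> (\<exists>!\<alpha>. crossing b n \<alpha>)) \<and>
    (\<lambda>n. alpha_star b n
          - (1 - (real b + 1)^2 / (real b * real n)
             + (real b + 1)^2 * (real b ^ 3 + real b * real (ell b n) - real b - 1)
                 / (real b ^ 3 * real n ^ 2)))
      \<in> O[inf at_top (principal {n. even n})](\<lambda>n. 1 / real n ^ 3) \<and>
    (\<forall>n. even n \<and> n \<ge> N_min b \<longrightarrow>
       (\<forall>\<alpha>. 1/2 < \<alpha> \<and> \<alpha> < alpha_star b n \<longrightarrow>
          {j. extremal \<alpha> (G_fam b n) (k_max b n) j} = {1}) \<and>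
       {j. extremal (alpha_star b n) (G_fam b n) (k_max b n) j} = {1, k_max b n} \<and>
       (\<forall>\<alpha>. alpha_star b n < \<alpha> \<and> \<alpha> < 1 \<longrightarrow>
          {j. extremal \<alpha> (G_fam b n) (k_max b n) j} = {k_max b n}))"
proof (intro conjI allI impI)
  fix n assume n: "even n \<and> N_min b \<le> n"
  note star = alpha_star_properties[OF assms, of n]
  show "\<exists>!\<alpha>. crossing b n \<alpha>" using star(1) n by auto
  have "crossing b n (alpha_star b n)" using star(1) n by simp
  then have \<alpha>0: "1 / 2 < alpha_star b n" "alpha_star b n < 1"
    "rho (alpha_star b n) (G_fam b n 1) = rho (alpha_star b n) (G_fam b n (k_max b n))"
    by (auto simp: crossing_def)
  then show "{j. extremal (alpha_star b n) (G_fam b n) (k_max b n) j} = {1, k_max b n}"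
    using extremal_G_fam[OF assms, of n "alpha_star b n"] n by simp
  show "{j. extremal \<alpha> (G_fam b n) (k_max b n) j} = {1}"
    if "1 / 2 < \<alpha> \<and> \<alpha> < alpha_star b n" for \<alpha>
    using extremal_G_fam[OF assms, of n \<alpha>] star(2)[of \<alpha>] n that \<alpha>0 by simp
  show "{j. extremal \<alpha> (G_fam b n) (k_max b n) j} = {k_max b n}"
    if "alpha_star b n < \<alpha> \<and> \<alpha> < 1" for \<alpha>
    using extremal_G_fam[OF assms, of n \<alpha>] star(3)[of \<alpha>] n that \<alpha>0 by simp
qed (rule alpha_star_expansion[OF assms])

end
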